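(* Let $X,Y\in\mathcal{B}_A(\mathcal{H})$ and $\alpha\in\mathbb{C}\setminus\{0\}$. Then for all $r\ge 1$, $$\omega_{\mathbb{A}}^{2r}\left(\begin{bmatrix} 0& X\\ Y& 0\end{bmatrix}\right)\le \frac{2^{r-2}\max\{1,|\alpha-1|^{r}\}}{|\alpha|^{r}}\max\{\lambda_r,\mu_r\}+\frac{2^{r-1}}{|\alpha|^{r}}\max\{\omega_A^{r}(XY),\omega_A^{r}(YX)\},$$ where $\lambda_r=\|(Y^{\sharp_A}Y)^r+(XX^{\sharp_A})^r\|_A$ and $\mu_r=\|(YY^{\sharp_A})^r+(X^{\sharp_A}X)^r\|_A$.
   Context: $\mathcal{H}$ is a complex Hilbert space, $\mathcal{B}(\mathcal{H})$ the bounded linear operators on it, and $A\in\mathcal{B}(\mathcal{H})$ is a fixed positive (semidefinite) operator. Put $\langle x,y\rangle_A=\langle Ax,y\rangle$ and $\|x\|_A=\langle x,x\rangle_A^{1/2}$. $\mathcal{B}_A(\mathcal{H})$ is the set of $T\in\mathcal{B}(\mathcal{H})$ for which there is $S\in\mathcal{B}(\mathcal{H})$ with $AS=T^*A$; for such $T$, $T^{\sharp_A}=A^\dagger T^*A$ ($A^\dagger$ the Moore-Penrose inverse), i.e. the unique bounded solution $S$ of $AS=T^*A$ with range in $\overline{\mathrm{ran}(A)}$. The $A$-operator seminorm is $\|T\|_A=\sup\{\|Tx\|_A/\|x\|_A : x\in\overline{\mathrm{ran}(A)},\ x\ne 0\}$, and the $A$-numerical radius is $\omega_A(T)=\sup\{|\langle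 Tx,x\rangle_A| : x\in\mathcal{H},\ \|x\|_A=1\}$. On $\mathcal{H}\oplus\mathcal{H}$ let $\mathbb{A}=\begin{bmatrix}A&0\\0&A\end{bmatrix}$; $\omega_{\mathbb{A}}$ is defined as $\omega_A$ with $\mathbb{A}$ in place of $A$. $\omega_A^s(T)$ means $(\omega_A(T))^s$. Powers: an operator $S\in\mathcal{B}_A(\mathcal{H})$ is $A$-positive if $AS\ge 0$ (e.g. $T^{\sharp_A}T$ and $TT^{\sharp_A}$). Every $S\in\mathcal{B}_A(\mathcal{H})$ induces a bounded operator $\tilde S$ on the Hilbert space completion of $\mathcal{H}/\ker A$ under $\langle\cdot,\cdot\rangle_A$, with $\|\tilde S\|=\|S\|_A$, and $\tilde S\ge 0$ if $S$ is $A$-positive; for real $r>0$ and $A$-positive $S,R$, $\|S^r+R^r\|_A$ means $\|\tilde S^r+\tilde R^r\|$ (for integer $r$ this is the seminorm of the ordinary sum of powers). *)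

theory Defs
  imports "HOL-Analysis.Analysis" "HOL-Computational_Algebra.Polynomial"
begin

section \<open>Complex Hilbert spaces\<close>

text \<open>The inner product is linear in its first argument. Since \<open>norm\<close> is nonnegative and definite,
  the last axiom makes \<open>cinner\<close> positive definite with the given norm as its norm; completeness
  comes from \<^class>\<open>banach\<close>.\<close>

class complex_hilbert = banach +
  fixes scaleC :: "complex \<Rightarrow> 'a \<Rightarrow> 'a" (infixr "*\<^sub>C" 75)
    and cinner :: "'a \<Rightarrow> 'a \<Rightarrow> complex"
  assumes scaleR_scaleC: "r *\<^sub>R x = complex_of_real r *\<^sub>C x"
    and scaleC_add_right: "c *\<^sub>C (x + y) = c *\<^sub>C x + c *\<^sub>C y"
    and scaleC_add_left: "(c + d) *\<^sub>C x = c *\<^sub>C x + d *\<^sub>C x"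
    and scaleC_scaleC: "c *\<^sub>C d *\<^sub>C x = (c * d) *\<^sub>C x"
    and cinner_commute: "cinner x y = cnj (cinner y x)"
    and cinner_add_left: "cinner (x + y) z = cinner x z + cinner y z"
    and cinner_scaleC_left: "cinner (c *\<^sub>C x) y = c * cinner x y"
    and cinner_norm: "cinner x x = complex_of_real ((norm x)\<^sup>2)"

text \<open>The orthogonal direct sum of two Hilbert spaces.\<close>

instantiation prod :: (complex_hilbert, complex_hilbert) complex_hilbert
begin

definition scaleC_prod :: "complex \<Rightarrow> 'a \<times> 'b \<Rightarrow> 'a \<times> 'b" where
  "scaleC_prod c z = (c *\<^sub>C fst z, c *\<^sub>C snd z)"

definition cinner_prod :: "'a \<times> 'b \<Rightarrow> 'a \<times> 'b \<Rightarrow> complex" where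
  "cinner_prod z w = cinner (fst z) (fst w) + cinner (snd z) (snd w)"

instance
proof
  fix x y z :: "'a \<times> 'b" and r :: real and c d :: complex
  show "r *\<^sub>R x = complex_of_real r *\<^sub>C x"
    by (simp add: scaleC_prod_def scaleR_prod_def scaleR_scaleC)
  show "c *\<^sub>C (x + y) = c *\<^sub>C x + c *\<^sub>C y"
    by (simp add: scaleC_prod_def scaleC_add_right)
  show "(c + d) *\<^sub>C x = c *\<^sub>C x + d *\<^sub>C x"
    by (simp add: scaleC_prod_def scaleC_add_left)
  show "c *\<^sub>C d *\<^sub>C x = (c * d) *\<^sub>C x"
    by (simp add: scaleC_prod_def scaleC_scaleC)
  show "cinner x y = cnj (cinner y x)"
    unfolding cinner_prod_def
    by (metis cinner_commute complex_cnj_add)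
  show "cinner (x + y) z = cinner x z + cinner y z"
    by (simp add: cinner_prod_def cinner_add_left)
  show "cinner (c *\<^sub>C x) y = c * cinner x y"
    by (simp add: cinner_prod_def scaleC_prod_def cinner_scaleC_left distrib_left)
  show "cinner x x = complex_of_real ((norm x)\<^sup>2)"
    by (simp add: cinner_prod_def cinner_norm norm_prod_def)
qed

end

section \<open>Bounded operators\<close>

text \<open>Elements of the library type of bounded linear functions are only real-linear.\<close>

definition bounded_ops :: "('a::complex_hilbert \<Rightarrow>\<^sub>L 'b::complex_hilbert) set" where
  "bounded_ops = {T. \<forall>c x. blinfun_apply T (c *\<^sub>C x) = c *\<^sub>C blinfun_apply T x}"

definition positive_op :: "('a::complex_hilbert \<Rightarrow>\<^sub>L 'a) \<Rightarrow> bool" where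
  "positive_op T \<longleftrightarrow> T \<in> bounded_ops \<and> (\<forall>x. cinner (T x) x \<in> \<real>\<^sub>\<ge>\<^sub>0)"

definition adjoint_op :: "('a::complex_hilbert \<Rightarrow>\<^sub>L 'a) \<Rightarrow> ('a \<Rightarrow>\<^sub>L 'a)" where
  "adjoint_op T = (THE S. S \<in> bounded_ops \<and> (\<forall>x y. cinner (T x) y = cinner x (S y)))"

text \<open>The operator \<open>(x, y) \<mapsto> (P x + Q y, R x + S y)\<close>.\<close>

definition block_op ::
  "('a::complex_hilbert \<Rightarrow>\<^sub>L 'a) \<Rightarrow> ('a \<Rightarrow>\<^sub>L 'a) \<Rightarrow> ('a \<Rightarrow>\<^sub>L 'a) \<Rightarrow> ('a \<Rightarrow>\<^sub>L 'a) \<Rightarrow> (('a \<times> 'a) \<Rightarrow>\<^sub>L ('a \<times> 'a))"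
  where "block_op P Q R S = Blinfun (\<lambda>z.
    (blinfun_apply P (fst z) + blinfun_apply Q (snd z), blinfun_apply R (fst z) + blinfun_apply S (snd z)))"

lemma block_op_apply: "blinfun_apply (block_op P Q R S) (x, y) =
    (blinfun_apply P x + blinfun_apply Q y, blinfun_apply R x + blinfun_apply S y)"
  unfolding block_op_def
  by (subst bounded_linear_Blinfun_apply) (auto intro!: bounded_linear_intros)

section \<open>The semi-inner product of a positive operator\<close>

definition A_inner :: "('a::complex_hilbert \<Rightarrow>\<^sub>L 'a) \<Rightarrow> 'a \<Rightarrow> 'a \<Rightarrow> complex" where
  "A_inner A x y = cinner (A x) y"

definition A_norm :: "('a::complex_hilbert \<Rightarrow>\<^sub>L 'a) \<Rightarrow> 'a \<Rightarrow> real" where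
  "A_norm A x = sqrt (Re (A_inner A x x))"

definition A_adjointable :: "('a::complex_hilbert \<Rightarrow>\<^sub>L 'a) \<Rightarrow> ('a \<Rightarrow>\<^sub>L 'a) set" where
  "A_adjointable A = {T \<in> bounded_ops. \<exists>S \<in> bounded_ops. A o\<^sub>L S = adjoint_op T o\<^sub>L A}"

text \<open>The operator \<open>A\<^sup>\<dagger> T\<^sup>* A\<close>, as the reduced solution of \<open>A S = T\<^sup>* A\<close>.\<close>

definition A_sharp :: "('a::complex_hilbert \<Rightarrow>\<^sub>L 'a) \<Rightarrow> ('a \<Rightarrow>\<^sub>L 'a) \<Rightarrow> ('a \<Rightarrow>\<^sub>L 'a)" where
  "A_sharp A T = (THE S. S \<in> bounded_ops \<and> A o\<^sub>L S = adjoint_op T o\<^sub>L A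
      \<and> range (blinfun_apply S) \<subseteq> closure (range (blinfun_apply A)))"

text \<open>Inserting 0 changes the supremum only for \<open>A = 0\<close>, where the set is empty; the numerical
  radius is then 0. For operators that are not bounded in the \<open>A\<close>-seminorm the value is unspecified,
  since the supremum is taken in the reals.\<close>

definition A_num_radius :: "('a::complex_hilbert \<Rightarrow>\<^sub>L 'a) \<Rightarrow> ('a \<Rightarrow>\<^sub>L 'a) \<Rightarrow> real" where
  "A_num_radius A T = Sup (insert 0 {cmod (A_inner A (T x) x) | x. A_norm A x = 1})"

section \<open>Completion of \<open>\<H> / ker A\<close> and induced operators\<close>

text \<open>A type cannot depend on the operator \<open>A\<close>, so a completion is given by a Hilbert space \<open>'k\<close>
  together with the canonical map \<open>J\<close> from \<open>'a\<close>. The kernel of \<open>J\<close> is \<open>ker A\<close>, so \<open>J\<close> is an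
  isometric embedding of the quotient with dense range; \<open>('k, J)\<close> is determined up to a unique
  unitary equivalence.\<close>

definition is_A_completion ::
  "('a::complex_hilbert \<Rightarrow>\<^sub>L 'a) \<Rightarrow> ('a \<Rightarrow>\<^sub>L 'k::complex_hilbert) \<Rightarrow> bool" where
  "is_A_completion A J \<longleftrightarrow> J \<in> bounded_ops \<and> (\<forall>x y. cinner (J x) (J y) = A_inner A x y)
      \<and> closure (range (blinfun_apply J)) = UNIV"

definition induced_op ::
  "('a::complex_hilbert \<Rightarrow>\<^sub>L 'k::complex_hilbert) \<Rightarrow> ('a \<Rightarrow>\<^sub>L 'a) \<Rightarrow> ('k \<Rightarrow>\<^sub>L 'k)" where
  "induced_op J S = (THE F. F \<in> bounded_ops \<and> F o\<^sub>L J = J o\<^sub>L S)"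

section \<open>Real powers of positive operators\<close>

definition poly_op :: "real poly \<Rightarrow> ('a::complex_hilbert \<Rightarrow>\<^sub>L 'a) \<Rightarrow> ('a \<Rightarrow>\<^sub>L 'a)" where
  "poly_op p S = (\<Sum>i\<le>degree p. coeff p i *\<^sub>R ((\<lambda>F. S o\<^sub>L F) ^^ i) id_blinfun)"

text \<open>Continuous functional calculus for \<open>t \<mapsto> t\<^sup>r\<close>, to be used for \<open>S \<ge> 0\<close> and \<open>r > 0\<close>: the
  spectrum of \<open>S\<close> lies in \<open>[0, \<parallel>S\<parallel>]\<close>, and \<open>S\<^sup>r\<close> is the norm limit of \<open>p\<^sub>n(S)\<close> for any polynomials
  \<open>p\<^sub>n\<close> converging to \<open>t\<^sup>r\<close> uniformly on this interval.\<close>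

definition powr_op :: "('a::complex_hilbert \<Rightarrow>\<^sub>L 'a) \<Rightarrow> real \<Rightarrow> ('a \<Rightarrow>\<^sub>L 'a)" where
  "powr_op S r = (THE R. \<forall>p :: nat \<Rightarrow> real poly.
      uniform_limit {0..norm S} (\<lambda>n t. poly (p n) t) (\<lambda>t. t powr r) sequentially \<longrightarrow>
      (\<lambda>n. poly_op (p n) S) \<longlonglongrightarrow> R)"

text \<open>The number \<open>\<parallel>S\<^sup>r + R\<^sup>r\<parallel>\<^sub>A\<close> for \<open>A\<close>-positive \<open>S\<close> and \<open>R\<close>, computed in the completion \<open>J\<close>.\<close>

definition powr_sum_norm ::
  "('a::complex_hilbert \<Rightarrow>\<^sub>L 'k::complex_hilbert) \<Rightarrow> real \<Rightarrow> ('a \<Rightarrow>\<^sub>L 'a) \<Rightarrow> ('a \<Rightarrow>\<^sub>L 'a) \<Rightarrow> real" where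
  "powr_sum_norm J r S R = norm (powr_op (induced_op J S) r + powr_op (induced_op J R) r)"

end

theory Submission
  imports Defs
begin

text \<open>On the completion \<open>K\<close> of \<open>\<H> / ker A\<close> the operators \<open>X\<close>, \<open>Y\<close> induce bounded operators \<open>F\<close>, \<open>G\<close>, and
  \<open>\<sharp>\<^sub>A\<close> becomes the Hilbert space adjoint, so the claim reduces to \<open>T = [[0, F], [G, 0]]\<close> on \<open>K \<oplus> K\<close>.
  For a unit vector \<open>e\<close>, a Buzano-type inequality applied to \<open>\<langle>T e, e\<rangle> \<langle>e, T\<^sup>* e\<rangle>\<close> bounds
  \<open>\<bar>\<alpha>\<bar> \<bar>\<langle>T e, e\<rangle>\<bar>\<^sup>2\<close> by \<open>max {1, \<bar>\<alpha> - 1\<bar>} \<parallel>T e\<parallel> \<parallel>T\<^sup>* e\<parallel> + \<bar>\<langle>T\<^sup>2 e, e\<rangle>\<bar>\<close>, where \<open>T\<^sup>2 = F G \<oplus> G F\<close>. Then take \<open>r\<close>-th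
  powers, using convexity of \<open>t\<^sup>r\<close>, and apply McCarthy's inequality \<open>\<langle>P e, e\<rangle>\<^sup>r \<le> \<langle>P\<^sup>r e, e\<rangle>\<close> to \<open>P = T\<^sup>* T\<close> and \<open>P = T T\<^sup>*\<close>.
  For the functional calculus behind \<open>P\<^sup>r\<close> one needs that \<open>p(S)\<close> is positive if \<open>p \<ge> 0\<close> on \<open>[0, \<parallel>S\<parallel>]\<close>;
  this follows by writing \<open>p\<close> in the Bernstein basis.\<close>

section \<open>Hilbert space geometry\<close>

lemma cinner_add_right: "cinner (x::'a::complex_hilbert) (y + z) = cinner x y + cinner x z"
  by (metis cinner_add_left cinner_commute complex_cnj_add)

lemma cinner_scaleC_right: "cinner (x::'a::complex_hilbert) (c *\<^sub>C y) = cnj c * cinner x y"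
  by (metis cinner_scaleC_left cinner_commute complex_cnj_mult)

lemma scaleC_minus1: "(-1) *\<^sub>C (x::'a::complex_hilbert) = - x"
  using scaleR_scaleC[of "-1" x] by simp

lemma cinner_minus_left: "cinner (- (x::'a::complex_hilbert)) y = - cinner x y"
  using cinner_scaleC_left[of "-1" x y] by (simp add: scaleC_minus1)

lemma cinner_minus_right: "cinner (x::'a::complex_hilbert) (- y) = - cinner x y"
  using cinner_scaleC_right[of x "-1" y] by (simp add: scaleC_minus1)

lemma cinner_diff_left: "cinner ((x::'a::complex_hilbert) - y) z = cinner x z - cinner y z"
  using cinner_add_left[of x "-y" z] by (simp add: cinner_minus_left)

lemma cinner_diff_right: "cinner (x::'a::complex_hilbert) (y - z) = cinner x y - cinner x z"
  using cinner_add_right[of x y "-z"] by (simp add: cinner_minus_right)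

lemma cinner_zero_left [simp]: "cinner (0::'a::complex_hilbert) y = 0"
  using cinner_add_left[of 0 0 y] by simp

lemma cinner_zero_right [simp]: "cinner (y::'a::complex_hilbert) 0 = 0"
  using cinner_add_right[of y 0 0] by simp

lemma cinner_scaleR_left: "cinner (r *\<^sub>R (x::'a::complex_hilbert)) y = of_real r * cinner x y"
  by (simp add: scaleR_scaleC cinner_scaleC_left)

lemma cinner_scaleR_right: "cinner (x::'a::complex_hilbert) (r *\<^sub>R y) = of_real r * cinner x y"
  by (simp add: scaleR_scaleC cinner_scaleC_right)

lemmas cinner_algebra = cinner_add_left cinner_add_right cinner_diff_left cinner_diff_right
  cinner_scaleC_left cinner_scaleC_right

lemma cinner_eq_zero_iff [simp]: "cinner (x::'a::complex_hilbert) x = 0 \<longleftrightarrow> x = 0"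
  by (simp add: cinner_norm)

lemma Re_cinner_self: "Re (cinner (x::'a::complex_hilbert) x) = (norm x)\<^sup>2"
  by (simp add: cinner_norm)

lemma scaleC_diff_right: "c *\<^sub>C ((x::'a::complex_hilbert) - y) = c *\<^sub>C x - c *\<^sub>C y"
  using scaleC_add_right[of c "x - y" y] by (simp add: algebra_simps)

lemma norm_scaleC: "norm (c *\<^sub>C (x::'a::complex_hilbert)) = cmod c * norm x"
proof -
  have "complex_of_real ((norm (c *\<^sub>C x))\<^sup>2) = complex_of_real ((cmod c * norm x)\<^sup>2)"
    unfolding cinner_norm[symmetric] cinner_scaleC_left cinner_scaleC_right power_mult_distrib
      of_real_mult complex_norm_square[of c]
    by (simp add: cinner_norm)
  then show ?thesis
    by (metis abs_norm_cancel norm_mult of_real_eq_iff power2_eq_iff_nonneg norm_ge_zero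
        mult_nonneg_nonneg)
qed

lemma norm_diff_sq:
  "(norm ((x::'a::complex_hilbert) - y))\<^sup>2 = (norm x)\<^sup>2 + (norm y)\<^sup>2 - 2 * Re (cinner x y)"
proof -
  have "Re (cinner y x) = Re (cinner x y)"
    using cinner_commute[of y x] by simp
  then show ?thesis
    using Re_cinner_self[of "x - y"] by (simp add: cinner_algebra Re_cinner_self)
qed

lemma norm_add_sq:
  "(norm ((x::'a::complex_hilbert) + y))\<^sup>2 = (norm x)\<^sup>2 + (norm y)\<^sup>2 + 2 * Re (cinner x y)"
  using norm_diff_sq[of x "-y"] by (simp add: cinner_minus_right)

lemma parallelogram:
  "(norm ((x::'a::complex_hilbert) + y))\<^sup>2 + (norm (x - y))\<^sup>2 = 2 * (norm x)\<^sup>2 + 2 * (norm y)\<^sup>2"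
  by (simp add: norm_add_sq norm_diff_sq)

text \<open>Pythagoras for removing from \<open>w\<close> its component along \<open>m\<close>. The
  same identity gives Cauchy-Schwarz and, in the projection theorem, the orthogonality of the
  residual.\<close>

lemma norm_diff_component_sq:
  fixes w m :: "'a::complex_hilbert"
  assumes "m \<noteq> 0"
  shows "(norm (w - (cinner w m / of_real ((norm m)\<^sup>2)) *\<^sub>C m))\<^sup>2
    = (norm w)\<^sup>2 - (cmod (cinner w m))\<^sup>2 / (norm m)\<^sup>2"
proof -
  define c where "c = cinner w m / of_real ((norm m)\<^sup>2)"
  have nm: "norm m > 0" using assms by simp
  have "cnj c * cinner w m = of_real ((cmod (cinner w m))\<^sup>2 / (norm m)\<^sup>2)"
    unfolding c_def using complex_norm_square[of "cinner w m"] by (simp add: mult.commute)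
  moreover have "cmod c = cmod (cinner w m) / (norm m)\<^sup>2"
    unfolding c_def using nm by (simp add: norm_divide norm_power)
  ultimately have "(norm (w - c *\<^sub>C m))\<^sup>2 = (norm w)\<^sup>2 +
      (cmod (cinner w m) / (norm m)\<^sup>2 * norm m)\<^sup>2 - 2 * ((cmod (cinner w m))\<^sup>2 / (norm m)\<^sup>2)"
    unfolding norm_diff_sq[of w] by (simp add: norm_scaleC cinner_scaleC_right)
  also have "(cmod (cinner w m) / (norm m)\<^sup>2 * norm m)\<^sup>2 = (cmod (cinner w m))\<^sup>2 / (norm m)\<^sup>2"
    using nm by (simp add: field_simps power2_eq_square)
  finally show ?thesis unfolding c_def by simp
qed

lemma cinner_Cauchy_Schwarz: "cmod (cinner (x::'a::complex_hilbert) y) \<le> norm x * norm y"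
proof (cases "y = 0")
  case False
  then have "(cmod (cinner x y))\<^sup>2 / (norm y)\<^sup>2 \<le> (norm x)\<^sup>2"
    using norm_diff_component_sq[OF False, of x] zero_le_power2 by (smt (verit))
  then have "(cmod (cinner x y))\<^sup>2 \<le> (norm x * norm y)\<^sup>2"
    using False by (simp add: field_simps)
  then show ?thesis by (rule power2_le_imp_le) simp
qed simp

lemma bounded_bilinear_cinner: "bounded_bilinear (cinner :: 'a::complex_hilbert \<Rightarrow> 'a \<Rightarrow> complex)"
proof
  show "\<exists>K. \<forall>a b::'a. cmod (cinner a b) \<le> norm a * norm b * K"
    using cinner_Cauchy_Schwarz by (intro exI[of _ 1]) auto
qed (auto simp: cinner_add_left cinner_add_right cinner_scaleR_left cinner_scaleR_right
    scaleR_conv_of_real)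

lemmas tendsto_cinner [tendsto_intros] = bounded_bilinear.tendsto[OF bounded_bilinear_cinner]
lemmas continuous_on_cinner [continuous_intros] =
  bounded_bilinear.continuous_on[OF bounded_bilinear_cinner]

lemma bounded_linear_scaleC: "bounded_linear (\<lambda>x::'a::complex_hilbert. c *\<^sub>C x)"
proof
  show "\<exists>K. \<forall>x::'a. norm (c *\<^sub>C x) \<le> norm x * K"
    by (intro exI[of _ "cmod c"]) (simp add: norm_scaleC mult.commute)
qed (auto simp: scaleC_add_right scaleR_scaleC scaleC_scaleC mult.commute)

lemmas tendsto_scaleC [tendsto_intros] = bounded_linear.tendsto[OF bounded_linear_scaleC]

lemma cinner_eqI:
  assumes "\<And>z. cinner (x::'a::complex_hilbert) z = cinner y z"
  shows "x = y"
  using assms[of "x - y"] by (metis cinner_diff_left cinner_eq_zero_iff eq_iff_diff_eq_0)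

section \<open>Orthogonal projection and Riesz representation\<close>

text \<open>A minimizing sequence for the distance from \<open>x\<close> to \<open>M\<close> is
  Cauchy by the parallelogram law. At its limit the residual is orthogonal to \<open>M\<close>,
  since a nonzero component along some \<open>m\<close> could be removed to come closer.\<close>

lemma orthogonal_projection_exists:
  fixes M :: "'a::complex_hilbert set"
  assumes cl: "closed M" and "0 \<in> M"
    and add: "\<And>a b. a \<in> M \<Longrightarrow> b \<in> M \<Longrightarrow> a + b \<in> M"
    and scale: "\<And>c a. a \<in> M \<Longrightarrow> c *\<^sub>C a \<in> M"
  shows "\<exists>p\<in>M. \<forall>m\<in>M. cinner (x - p) m = 0"
proof -
  define d where "d = infdist x M"
  have "M \<noteq> {}" using \<open>0 \<in> M\<close> by auto
  have d_le: "d \<le> norm (x - m)" if "m \<in> M" for m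
    unfolding d_def using infdist_le[OF that, of x] by (simp add: dist_norm)
  have d0: "d \<ge> 0" unfolding d_def by (rule infdist_nonneg)
  have "\<exists>m\<in>M. norm (x - m) < d + 1 / real (Suc n)" for n
  proof -
    have "infdist x M < d + 1 / real (Suc n)" by (simp add: d_def)
    then show ?thesis
      unfolding infdist_notempty[OF \<open>M \<noteq> {}\<close>]
      by (subst (asm) cInf_less_iff) (use \<open>M \<noteq> {}\<close> in \<open>auto simp: dist_norm intro!: bdd_belowI[of _ 0]\<close>)
  qed
  then obtain p where pM: "\<And>n. p n \<in> M" and p: "\<And>n. norm (x - p n) < d + 1 / real (Suc n)"
    by metis
  \<comment> \<open>The midpoint of \<open>p m\<close> and \<open>p n\<close> lies in
    \<open>M\<close>, so the sum of the two residuals has norm at least 2 d; the parallelogram law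
    turns this into a bound on their difference.\<close>
  have par: "(norm (p m - p n))\<^sup>2 \<le> 2 * (norm (x - p m))\<^sup>2 + 2 * (norm (x - p n))\<^sup>2 - 4 * d\<^sup>2" for m n
  proof -
    have "(1/2) *\<^sub>R (p m + p n) \<in> M"
      using add[OF pM[of m] pM[of n]] scale by (simp add: scaleR_scaleC)
    then have "2 * d \<le> 2 * norm (x - (1/2) *\<^sub>R (p m + p n))" using d_le by simp
    also have "\<dots> = norm (2 *\<^sub>R (x - (1/2) *\<^sub>R (p m + p n)))" by simp
    also have "2 *\<^sub>R (x - (1/2) *\<^sub>R (p m + p n)) = (x - p m) + (x - p n)"
      by (simp add: scaleR_diff_right scaleR_2)
    finally have "(2 * d)\<^sup>2 \<le> (norm ((x - p m) + (x - p n)))\<^sup>2"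
      using d0 by (intro power_mono) auto
    then show ?thesis
      using parallelogram[of "x - p m" "x - p n"] by (simp add: norm_minus_commute power_mult_distrib)
  qed
  have lim: "(\<lambda>n. norm (x - p n)) \<longlonglongrightarrow> d"
  proof (rule tendsto_sandwich[OF _ _ tendsto_const])
    show "(\<lambda>n. d + 1 / real (Suc n)) \<longlonglongrightarrow> d"
      using tendsto_add[OF tendsto_const[of d] lim_1_over_n[THEN LIMSEQ_Suc]] by simp
  qed (use d_le pM p in \<open>auto intro!: always_eventually less_imp_le\<close>)
  have "Cauchy p"
  proof (rule metric_CauchyI)
    fix e :: real assume "e > 0"
    have "(\<lambda>n. 2 * (norm (x - p n))\<^sup>2 - 2 * d\<^sup>2) \<longlonglongrightarrow> 2 * d\<^sup>2 - 2 * d\<^sup>2"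
      by (intro tendsto_intros lim)
    then have "\<forall>\<^sub>F n in sequentially. 2 * (norm (x - p n))\<^sup>2 - 2 * d\<^sup>2 < e\<^sup>2 / 2"
      using \<open>e > 0\<close> by (intro order_tendstoD) auto
    then obtain N where N: "\<And>n. n \<ge> N \<Longrightarrow> 2 * (norm (x - p n))\<^sup>2 - 2 * d\<^sup>2 < e\<^sup>2 / 2"
      by (auto simp: eventually_sequentially)
    have "dist (p m) (p n) < e" if "m \<ge> N" "n \<ge> N" for m n
    proof -
      have "(norm (p m - p n))\<^sup>2 < e\<^sup>2" using par[of m n] N[OF that(1)] N[OF that(2)] by linarith
      then show ?thesis using \<open>e > 0\<close> by (auto simp: dist_norm intro: power_less_imp_less_base)
    qed
    then show "\<exists>N. \<forall>m\<ge>N. \<forall>n\<ge>N. dist (p m) (p n) < e" by blast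
  qed
  then obtain q where q: "p \<longlonglongrightarrow> q" using Cauchy_convergent_iff convergent_def by blast
  have qM: "q \<in> M" using closed_sequentially[OF cl pM q] .
  have "(\<lambda>n. norm (x - p n)) \<longlonglongrightarrow> norm (x - q)" by (intro tendsto_intros q)
  then have dq: "norm (x - q) = d" using lim LIMSEQ_unique by blast
  have "cinner (x - q) m = 0" if "m \<in> M" for m
  proof (cases "m = 0")
    case False
    define c where "c = cinner (x - q) m / of_real ((norm m)\<^sup>2)"
    have "d \<le> norm (x - (q + c *\<^sub>C m))" using that qM add scale by (intro d_le) auto
    then have "d\<^sup>2 \<le> (norm (x - q - c *\<^sub>C m))\<^sup>2"
      using d0 by (intro power_mono) (auto simp: algebra_simps)
    then have "(cmod (cinner (x - q) m))\<^sup>2 / (norm m)\<^sup>2 \<le> 0"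
      using norm_diff_component_sq[OF False, of "x - q"] unfolding c_def dq by linarith
    moreover have "(norm m)\<^sup>2 > 0" using False by simp
    ultimately have "(cmod (cinner (x - q) m))\<^sup>2 \<le> 0"
      by (metis divide_le_0_iff not_less)
    then show ?thesis by simp
  qed simp
  then show ?thesis using qM by blast
qed

text \<open>Take \<open>w\<close>, the component orthogonal to the kernel of \<open>f\<close> of
  some \<open>x\<close> with f x \<noteq> 0. For every \<open>z\<close> the vector f w z - f z w
  lies in the kernel, and pairing it with \<open>w\<close> yields the representing multiple of
  \<open>w\<close>.\<close>

lemma Riesz_representation:
  fixes f :: "'a::complex_hilbert \<Rightarrow> complex"
  assumes bl: "bounded_linear f" and scale: "\<And>c x. f (c *\<^sub>C x) = c * f x"
  shows "\<exists>y. \<forall>x. f x = cinner x y"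
proof (cases "\<forall>x. f x = 0")
  case True
  then show ?thesis by (intro exI[of _ 0]) simp
next
  case False
  then obtain x where x: "f x \<noteq> 0" by blast
  interpret f: bounded_linear f by (rule bl)
  have "closed {z. f z = 0}"
    using f.continuous_on[OF continuous_on_id] by (intro closed_Collect_eq continuous_intros) auto
  then obtain p where p: "f p = 0" and orth: "\<And>m. f m = 0 \<Longrightarrow> cinner (x - p) m = 0"
    using orthogonal_projection_exists[of "{z. f z = 0}" x] by (auto simp: f.zero f.add scale)
  define w where "w = x - p"
  have fw: "f w = f x" unfolding w_def by (simp add: f.diff p)
  have w0: "w \<noteq> 0" using fw x f.zero by auto
  have key: "f z = cinner z ((cnj (f w) / of_real ((norm w)\<^sup>2)) *\<^sub>C w)" for z
  proof -
    have "f (f w *\<^sub>C z - f z *\<^sub>C w) = 0" by (simp add: f.diff scale)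
    then have "cinner w (f w *\<^sub>C z - f z *\<^sub>C w) = 0" using orth unfolding w_def by blast
    then have "cinner (f w *\<^sub>C z - f z *\<^sub>C w) w = 0"
      using cinner_commute by (metis complex_cnj_zero_iff)
    then have "f w * cinner z w = f z * of_real ((norm w)\<^sup>2)"
      by (simp add: cinner_algebra cinner_norm)
    then show ?thesis using w0 by (simp add: cinner_scaleC_right field_simps)
  qed
  then show ?thesis by blast
qed

section \<open>Adjoints\<close>

lemma bounded_opsD: "T \<in> bounded_ops \<Longrightarrow> blinfun_apply T (c *\<^sub>C x) = c *\<^sub>C blinfun_apply T x"
  by (simp add: bounded_ops_def)

text \<open>Riesz supplies \<open>S y\<close> for each \<open>y\<close>. The representing vector is
  unique, which makes \<open>S\<close> linear; pairing \<open>S y\<close> with itself bounds it in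
  terms of the norm of \<open>T\<close>.\<close>

lemma adjoint_exists:
  fixes T :: "'a::complex_hilbert \<Rightarrow>\<^sub>L 'b::complex_hilbert"
  assumes T: "T \<in> bounded_ops"
  shows "\<exists>S\<in>bounded_ops. \<forall>x y. cinner (T x) y = cinner x (blinfun_apply S y)"
proof -
  have "\<exists>w. \<forall>x. cinner (T x) y = cinner x w" for y
  proof (rule Riesz_representation)
    show "bounded_linear (\<lambda>x. cinner (T x) y)"
      using bounded_linear_compose[OF bounded_bilinear.bounded_linear_left[OF bounded_bilinear_cinner]
        blinfun.bounded_linear_right] by blast
  qed (simp add: bounded_opsD[OF T] cinner_scaleC_left)
  then obtain S where S: "\<And>x y. cinner (T x) y = cinner x (S y)" by metis
  have eqI: "S a = b" if "\<And>x. cinner (T x) a = cinner x b" for a b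
    by (rule cinner_eqI) (metis S that cinner_commute)
  have bl: "bounded_linear S"
  proof (rule bounded_linear_intro)
    show "S (x + y) = S x + S y" for x y by (rule eqI) (simp add: cinner_add_right S)
    show "S (r *\<^sub>R x) = r *\<^sub>R S x" for r x by (rule eqI) (simp add: cinner_scaleR_right S)
    show "norm (S y) \<le> norm y * norm T" for y
    proof (cases "S y = 0")
      case False
      have "norm (S y) * norm (S y) = cmod (cinner (S y) (S y))"
        by (simp add: cinner_norm power2_eq_square norm_mult)
      also have "\<dots> \<le> norm (T (S y)) * norm y"
        unfolding S[symmetric] by (rule cinner_Cauchy_Schwarz)
      also have "\<dots> \<le> (norm T * norm (S y)) * norm y"
        by (intro mult_right_mono norm_blinfun) auto
      finally show ?thesis using False by (simp add: mult.commute)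
    qed simp
  qed
  have "Blinfun S \<in> bounded_ops"
    unfolding bounded_ops_def
    by (auto simp: bounded_linear_Blinfun_apply[OF bl] cinner_scaleC_right S intro!: eqI)
  then show ?thesis using S by (intro bexI[of _ "Blinfun S"]) (auto simp: bounded_linear_Blinfun_apply[OF bl])
qed

text \<open>The adjoint is unique, so the definite description in \<open>adjoint_op\<close> denotes
  the operator that Riesz provides.\<close>

lemma adjoint_op_works:
  fixes T :: "'a::complex_hilbert \<Rightarrow>\<^sub>L 'a"
  assumes "T \<in> bounded_ops"
  shows "adjoint_op T \<in> bounded_ops" and "cinner (T x) y = cinner x (adjoint_op T y)"
proof -
  obtain S where S: "S \<in> bounded_ops" "\<And>x y. cinner (T x) y = cinner x (blinfun_apply S y)"
    using adjoint_exists[OF assms] by blast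
  have "S' = S" if "\<forall>x y. cinner (T x) y = cinner x (blinfun_apply S' y)" for S'
    by (intro blinfun_eqI cinner_eqI) (metis S(2) that cinner_commute)
  then have "adjoint_op T = S" unfolding adjoint_op_def using S by (intro the_equality) auto
  then show "adjoint_op T \<in> bounded_ops" "cinner (T x) y = cinner x (adjoint_op T y)"
    using S by auto
qed

lemma adjoint_op_left:
  fixes T :: "'a::complex_hilbert \<Rightarrow>\<^sub>L 'a"
  assumes "T \<in> bounded_ops"
  shows "cinner (adjoint_op T x) y = cinner x (T y)"
  by (metis adjoint_op_works(2)[OF assms] cinner_commute)

section \<open>Operators induced on the completion\<close>

text \<open>Needed for the range of \<open>A\<close> and for the graph {(J x, J T x)}.\<close>

lemma closure_complex_subspace:
  fixes S :: "'a::complex_hilbert set"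
  assumes add: "\<And>a b. a \<in> S \<Longrightarrow> b \<in> S \<Longrightarrow> a + b \<in> S"
    and scale: "\<And>c a. a \<in> S \<Longrightarrow> c *\<^sub>C a \<in> S"
  shows "\<And>a b. a \<in> closure S \<Longrightarrow> b \<in> closure S \<Longrightarrow> a + b \<in> closure S"
    and "\<And>c a. a \<in> closure S \<Longrightarrow> c *\<^sub>C a \<in> closure S"
proof -
  show "a + b \<in> closure S" if ab: "a \<in> closure S" "b \<in> closure S" for a b
  proof -
    obtain f g where "\<And>n. f n \<in> S" "f \<longlonglongrightarrow> a" "\<And>n. g n \<in> S" "g \<longlonglongrightarrow> b"
      using ab unfolding closure_sequential by blast
    then have "\<And>n. f n + g n \<in> S" "(\<lambda>n. f n + g n) \<longlonglongrightarrow> a + b"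
      by (auto intro: add tendsto_add)
    then show ?thesis unfolding closure_sequential by (intro exI[of _ "\<lambda>n. f n + g n"]) auto
  qed
  show "c *\<^sub>C a \<in> closure S" if ab: "a \<in> closure S" for c a
  proof -
    obtain f where "\<And>n. f n \<in> S" "f \<longlonglongrightarrow> a"
      using ab unfolding closure_sequential by blast
    then have "\<And>n. c *\<^sub>C f n \<in> S" "(\<lambda>n. c *\<^sub>C f n) \<longlonglongrightarrow> c *\<^sub>C a"
      by (auto intro: scale tendsto_scaleC)
    then show ?thesis unfolding closure_sequential by (intro exI[of _ "\<lambda>n. c *\<^sub>C f n"]) auto
  qed
qed

text \<open>Orthogonality of the residual determines the projection uniquely, which makes it linear;
  Pythagoras makes it a contraction.\<close>

lemma orthogonal_projection_op_exists:
  fixes M :: "'a::complex_hilbert set"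
  assumes cl: "closed M" and zero: "0 \<in> M"
    and add: "\<And>a b. a \<in> M \<Longrightarrow> b \<in> M \<Longrightarrow> a + b \<in> M"
    and scale: "\<And>c a. a \<in> M \<Longrightarrow> c *\<^sub>C a \<in> M"
  shows "\<exists>P\<in>bounded_ops. \<forall>x. blinfun_apply P x \<in> M \<and> (\<forall>m\<in>M. cinner (x - blinfun_apply P x) m = 0)"
proof -
  obtain P where PM: "\<And>x. P x \<in> M" and orth: "\<And>x m. m \<in> M \<Longrightarrow> cinner (x - P x) m = 0"
    using orthogonal_projection_exists[OF assms] by metis
  have eqI: "P x = p" if "p \<in> M" and "\<And>m. m \<in> M \<Longrightarrow> cinner (x - p) m = 0" for x p
  proof -
    have m: "P x - p \<in> M"
      using add[OF PM[of x] scale[OF \<open>p \<in> M\<close>, of "-1"]] by (simp add: scaleC_minus1)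
    have "cinner (P x - p) (P x - p) = cinner (x - p) (P x - p) - cinner (x - P x) (P x - p)"
      by (simp flip: cinner_diff_left)
    then show ?thesis using that(2)[OF m] orth[OF m, of x] by simp
  qed
  have scaleP: "P (c *\<^sub>C x) = c *\<^sub>C P x" for c x
    by (rule eqI) (auto simp: scale PM orth cinner_scaleC_left simp flip: scaleC_diff_right)
  have bl: "bounded_linear P"
  proof (rule bounded_linear_intro)
    show "P (x + y) = P x + P y" for x y
    proof (rule eqI)
      fix m assume "m \<in> M"
      then show "cinner (x + y - (P x + P y)) m = 0"
        using orth[of m x] orth[of m y] by (simp add: cinner_algebra)
    qed (simp add: add PM)
    show "P (r *\<^sub>R x) = r *\<^sub>R P x" for r x by (simp add: scaleR_scaleC scaleP)
    show "norm (P x) \<le> norm x * 1" for x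
    proof -
      have "(norm x)\<^sup>2 = (norm (x - P x))\<^sup>2 + (norm (P x))\<^sup>2"
        using norm_add_sq[of "x - P x" "P x"] orth[OF PM, of x x] by simp
      then show ?thesis by (intro power2_le_imp_le[of "norm (P x)"]) auto
    qed
  qed
  show ?thesis
    by (rule bexI[of _ "Blinfun P"])
      (auto simp: bounded_linear_Blinfun_apply[OF bl] PM orth bounded_ops_def scaleP)
qed

section \<open>The semi-inner product and the sharp operation\<close>

lemma bounded_ops_compose:
  "F \<in> bounded_ops \<Longrightarrow> G \<in> bounded_ops \<Longrightarrow> F o\<^sub>L G \<in> bounded_ops"
  by (simp add: bounded_ops_def)

lemma A_completionD:
  assumes "is_A_completion A J"
  shows "J \<in> bounded_ops" and "cinner (blinfun_apply J x) (J y) = cinner (A x) y"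
    and "closure (range (blinfun_apply J)) = UNIV"
  using assms by (auto simp: is_A_completion_def A_inner_def)

text \<open>The form <A x, y> is the pullback <J x, J y> of an inner product and therefore
  Hermitian.\<close>

lemma A_completion_symmetric:
  assumes "is_A_completion A J"
  shows "cinner (blinfun_apply A x) y = cinner x (A y)"
  using A_completionD(2)[OF assms, of x y] A_completionD(2)[OF assms, of y x]
    cinner_commute[of "J x" "J y"] cinner_commute[of "A y" x] by simp

text \<open>Existence: compose any solution \<open>S\<close> with the orthogonal projection
  \<open>P\<close> onto the closure of ran A; A P = A because x - P x is orthogonal to ran A and
  \<open>A\<close> is symmetric. Uniqueness: the kernel of \<open>A\<close> meets that closure only
  in 0.\<close>

lemma A_sharp_works:
  assumes A: "A \<in> bounded_ops"
    and sym: "\<And>x y. cinner (blinfun_apply A x) y = cinner x (A y)"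
    and T: "T \<in> A_adjointable A"
  shows "A_sharp A T \<in> bounded_ops" and "A o\<^sub>L A_sharp A T = adjoint_op T o\<^sub>L A"
proof -
  define M where "M = closure (range (blinfun_apply A))"
  have "0 \<in> range (blinfun_apply A)" by (rule range_eqI[of _ _ 0]) (simp add: blinfun.zero_right)
  then have zero: "0 \<in> M" unfolding M_def by (rule subsetD[OF closure_subset])
  have rng_add: "a + b \<in> range (blinfun_apply A)"
    if ab: "a \<in> range (blinfun_apply A)" "b \<in> range (blinfun_apply A)" for a b
  proof -
    obtain x y where "a = A x" "b = A y" using ab by blast
    then show ?thesis by (intro range_eqI[of _ _ "x + y"]) (simp add: blinfun.add_right)
  qed
  have rng_scale: "c *\<^sub>C a \<in> range (blinfun_apply A)" if ab: "a \<in> range (blinfun_apply A)" for a c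
  proof -
    obtain x where "a = A x" using ab by blast
    then show ?thesis by (intro range_eqI[of _ _ "c *\<^sub>C x"]) (simp add: bounded_opsD[OF A])
  qed
  note sub = closure_complex_subspace[of "range (blinfun_apply A)", folded M_def]
  have addM: "a + b \<in> M" if "a \<in> M" "b \<in> M" for a b using sub(1) rng_add rng_scale that by blast
  have scaleM: "c *\<^sub>C a \<in> M" if "a \<in> M" for c a using sub(2) rng_add rng_scale that by blast
  obtain P where P: "P \<in> bounded_ops" "\<And>x. blinfun_apply P x \<in> M"
    "\<And>x m. m \<in> M \<Longrightarrow> cinner (x - blinfun_apply P x) m = 0"
    using orthogonal_projection_op_exists[of M] zero addM scaleM unfolding M_def by auto
  have AP: "A (P x) = A x" for x
  proof (rule cinner_eqI)
    fix z
    have "A z \<in> M" unfolding M_def by (rule subsetD[OF closure_subset rangeI])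
    then have "cinner (x - P x) (A z) = 0" by (rule P(3))
    then show "cinner (A (P x)) z = cinner (A x) z" by (simp add: sym cinner_algebra)
  qed
  obtain S where S: "S \<in> bounded_ops" "A o\<^sub>L S = adjoint_op T o\<^sub>L A"
    using T by (auto simp: A_adjointable_def)
  let ?P = "\<lambda>S. S \<in> bounded_ops \<and> A o\<^sub>L S = adjoint_op T o\<^sub>L A \<and> range (blinfun_apply S) \<subseteq> M"
  have ex: "?P (P o\<^sub>L S)"
  proof (intro conjI)
    show "A o\<^sub>L (P o\<^sub>L S) = adjoint_op T o\<^sub>L A"
      using S(2) by (intro blinfun_eqI) (metis AP blinfun_apply_blinfun_compose)
  qed (auto simp: P S bounded_ops_compose)
  \<comment> \<open>Symmetry makes the kernel of \<open>A\<close> orthogonal to ran A and hence to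
    its closure, so \<open>w\<close> is orthogonal to itself.\<close>
  have kernel: "w = 0" if "w \<in> M" "A w = 0" for w
  proof -
    have "closed {m. cinner w m = 0}"
      by (intro closed_Collect_eq continuous_intros)
    moreover have "range (blinfun_apply A) \<subseteq> {m. cinner w m = 0}"
      using that(2) by (auto simp flip: sym)
    ultimately have "M \<subseteq> {m. cinner w m = 0}" unfolding M_def by (intro closure_minimal)
    then show ?thesis using that(1) by auto
  qed
  have "S1 = S2" if "?P S1" "?P S2" for S1 S2
  proof (rule blinfun_eqI)
    fix x
    have "A (S1 x) = A (S2 x)" using that by (metis blinfun_apply_blinfun_compose)
    then have "A (S1 x - S2 x) = 0" by (simp add: blinfun.diff_right)
    moreover have "S1 x \<in> M" "S2 x \<in> M" using that by (blast intro: rangeI)+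
    then have "S1 x + (-1) *\<^sub>C S2 x \<in> M" by (intro addM scaleM)
    then have "S1 x - S2 x \<in> M" by (simp add: scaleC_minus1)
    ultimately have "S1 x - S2 x = 0" using kernel by blast
    then show "S1 x = S2 x" by simp
  qed
  then have "\<exists>!S. ?P S" using ex by blast
  then have "?P (A_sharp A T)" unfolding A_sharp_def M_def[symmetric] by (rule theI')
  then show "A_sharp A T \<in> bounded_ops" "A o\<^sub>L A_sharp A T = adjoint_op T o\<^sub>L A" by auto
qed

text \<open>Log-convexity of \<open>n \<mapsto> \<parallel>J R\<^sup>n x\<parallel>\<close> (Krein): if \<open>\<parallel>J R x\<parallel> > \<parallel>R\<parallel> \<parallel>J x\<parallel>\<close>, this sequence would
  grow faster than \<open>\<parallel>R\<parallel>\<^sup>n\<close>.\<close>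

lemma symmetric_seminorm_bound:
  fixes J :: "'a::complex_hilbert \<Rightarrow>\<^sub>L 'k::complex_hilbert" and R :: "'a \<Rightarrow>\<^sub>L 'a"
  assumes sym: "\<And>x y. cinner (J (R x)) (J y) = cinner (J x) (J (R y))"
  shows "norm (J (R x)) \<le> norm R * norm (J x)"
proof -
  define a where "a n = norm (J ((blinfun_apply R ^^ n) x))" for n
  have a_nonneg: "a n \<ge> 0" for n by (simp add: a_def)
  \<comment> \<open>Cauchy-Schwarz after one \<open>R\<close> is moved across the inner
    product.\<close>
  have convex: "(a (Suc n))\<^sup>2 \<le> a n * a (Suc (Suc n))" for n
  proof -
    let ?y = "(blinfun_apply R ^^ n) x"
    have "(a (Suc n))\<^sup>2 = cmod (cinner (J (R ?y)) (J (R ?y)))"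
      by (simp add: a_def cinner_norm norm_power)
    also have "\<dots> = cmod (cinner (J ?y) (J (R (R ?y))))" by (simp add: sym)
    also have "\<dots> \<le> norm (J ?y) * norm (J (R (R ?y)))" by (rule cinner_Cauchy_Schwarz)
    finally show ?thesis by (simp add: a_def)
  qed
  have "a 1 \<le> norm R * a 0"
  proof (cases "a 0 = 0")
    case True
    then show ?thesis using convex[of 0] by simp
  next
    case False
    then have a0: "a 0 > 0" using a_nonneg[of 0] by simp
    \<comment> \<open>The quotients a (n + 1) / a n are at least a 1 / a 0; the product form avoids
      dividing by a term not yet known to be positive.\<close>
    have ratio: "a n * a 1 \<le> a (Suc n) * a 0" for n
    proof (induction n)
      case (Suc n)
      show ?case
      proof (cases "a (Suc n) = 0")
        case False
        then have pos: "a (Suc n) > 0" using a_nonneg by (metis less_eq_real_def)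
        then have "0 < a n * a (Suc (Suc n))" using convex[of n] by (smt (verit) zero_less_power)
        then have "a n > 0" using a_nonneg[of n] by (simp add: zero_less_mult_iff)
        have "a n * (a (Suc n) * a 1) \<le> a (Suc n) * (a (Suc n) * a 0)"
          using mult_left_mono[OF Suc less_imp_le[OF pos]] by (simp add: algebra_simps)
        also have "\<dots> \<le> a n * (a (Suc (Suc n)) * a 0)"
          using mult_right_mono[OF convex[of n] less_imp_le[OF a0]]
          by (simp add: algebra_simps power2_eq_square)
        finally show ?thesis using \<open>a n > 0\<close> by simp
      qed (use a_nonneg in \<open>auto intro: mult_nonneg_nonneg\<close>)
    qed simp
    define \<rho> where "\<rho> = a 1 / a 0"
    have lower: "\<rho> ^ n * a 0 \<le> a n" for n
    proof (induction n)
      case (Suc n)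
      have "\<rho> \<ge> 0" using a_nonneg a0 by (simp add: \<rho>_def)
      have "\<rho> ^ Suc n * a 0 \<le> \<rho> * a n" using mult_left_mono[OF Suc \<open>\<rho> \<ge> 0\<close>] by simp
      also have "\<dots> \<le> a (Suc n)" using ratio[of n] a0 by (simp add: \<rho>_def field_simps)
      finally show ?case .
    qed simp
    have iter: "norm ((blinfun_apply R ^^ n) x) \<le> norm R ^ n * norm x" for n
    proof (induction n)
      case (Suc n)
      then show ?case
        using order_trans[OF norm_blinfun mult_left_mono[OF Suc norm_ge_zero]]
        by (simp add: mult.assoc)
    qed simp
    have upper: "a n \<le> norm J * (norm R ^ n * norm x)" for n
      unfolding a_def using order_trans[OF norm_blinfun mult_left_mono[OF iter norm_ge_zero]] .
    have "\<rho> \<le> norm R"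
    proof (rule ccontr)
      assume "\<not> \<rho> \<le> norm R"
      then have gt: "norm R < \<rho>" by simp
      show False
      proof (cases "norm R = 0")
        case True
        then have "a 1 \<le> 0" using upper[of 1] by simp
        then have "\<rho> \<le> 0" using a0 by (simp add: \<rho>_def divide_le_0_iff)
        then show False using gt True by simp
      next
        case False
        then have R: "norm R > 0" by simp
        then have "\<rho> / norm R > 1" using gt by simp
        then obtain n where n: "norm J * norm x / a 0 < (\<rho> / norm R) ^ n"
          using real_arch_pow by blast
        have "norm J * norm x * norm R ^ n < \<rho> ^ n * a 0"
          using n R a0 by (simp add: field_simps power_divide)
        then show False using lower[of n] upper[of n] by (simp add: algebra_simps)
      qed
    qed
    then show ?thesis using a0 by (simp add: \<rho>_def field_simps)
  qed
  then show ?thesis by (simp add: a_def)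
qed

text \<open>Both sides equal <A x, T y>, so any solution \<open>S\<close>, reduced or not, is
  adjoint to \<open>T\<close> for the semi-inner product.\<close>

lemma A_adjoint_inner:
  assumes c: "is_A_completion A J" and T: "T \<in> bounded_ops"
    and S: "A o\<^sub>L S = adjoint_op T o\<^sub>L A"
  shows "cinner (J (S x)) (J y) = cinner (J x) (J (T y))"
proof -
  have "A (S x) = adjoint_op T (A x)" by (metis S blinfun_apply_blinfun_compose)
  then show ?thesis by (simp add: A_completionD(2)[OF c] adjoint_op_left[OF T])
qed

text \<open>R = S T is symmetric for the semi-inner product and ||J T x||^2 = <J R x, J x>. The
  seminorm bound for \<open>R\<close> thus gives the constant sqrt (norm R).\<close>

lemma A_adjointable_bounded:
  assumes c: "is_A_completion A J" and T: "T \<in> A_adjointable A"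
  shows "\<exists>C\<ge>0. \<forall>x. norm (J (blinfun_apply T x)) \<le> C * norm (J x)"
proof -
  obtain S where S: "A o\<^sub>L S = adjoint_op T o\<^sub>L A" and Tb: "T \<in> bounded_ops"
    using T by (auto simp: A_adjointable_def)
  note adj = A_adjoint_inner[OF c Tb S]
  define R where "R = S o\<^sub>L T"
  have R1: "cinner (J (R x)) (J y) = cinner (J (T x)) (J (T y))" for x y
    by (simp add: R_def adj)
  have R2: "cinner (J x) (J (R y)) = cinner (J (T x)) (J (T y))" for x y
    by (metis R1 cinner_commute)
  have "norm (J (T x)) \<le> sqrt (norm R) * norm (J x)" for x
  proof (rule power2_le_imp_le)
    have "(norm (J (T x)))\<^sup>2 = cmod (cinner (J (R x)) (J x))"
      by (simp add: R1 cinner_norm norm_power)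
    also have "\<dots> \<le> norm (J (R x)) * norm (J x)" by (rule cinner_Cauchy_Schwarz)
    also have "\<dots> \<le> (norm R * norm (J x)) * norm (J x)"
      by (intro mult_right_mono symmetric_seminorm_bound) (simp_all add: R1 R2)
    finally show "(norm (J (T x)))\<^sup>2 \<le> (sqrt (norm R) * norm (J x))\<^sup>2"
      by (simp add: power_mult_distrib) (simp add: power2_eq_square)
  qed simp
  then show ?thesis by (intro exI[of _ "sqrt (norm R)"]) simp
qed

section \<open>Extension by density from the range of \<open>J\<close>\<close>

lemma blinfun_eq_on_dense:
  fixes J :: "'a::real_normed_vector \<Rightarrow>\<^sub>L 'k::real_normed_vector"
    and F G :: "'k \<Rightarrow>\<^sub>L 'b::real_normed_vector"
  assumes "closure (range (blinfun_apply J)) = UNIV" and "\<And>x. F (J x) = G (J x)"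
  shows "F = G"
proof (rule blinfun_eqI)
  fix z
  have "closure (range (blinfun_apply J)) \<subseteq> {z. F z = G z}"
    using assms(2) by (intro closure_minimal closed_Collect_eq continuous_intros) auto
  then show "F z = G z" using assms(1) by auto
qed

text \<open>Operators that agree on the dense range of \<open>J\<close> coincide, so an induced
  operator is identified by checking a candidate there.\<close>

lemma induced_op_eqI:
  assumes c: "is_A_completion A J" and F: "F \<in> bounded_ops" "\<And>x. F (J x) = J (blinfun_apply S x)"
  shows "induced_op J S = F"
  unfolding induced_op_def
proof (rule the_equality)
  show "F \<in> bounded_ops \<and> F o\<^sub>L J = J o\<^sub>L S" using F by (auto intro: blinfun_eqI)
next
  fix G assume "G \<in> bounded_ops \<and> G o\<^sub>L J = J o\<^sub>L S"
  then have "G (J x) = F (J x)" for x by (metis F(2) blinfun_apply_blinfun_compose)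
  then show "G = F" by (rule blinfun_eq_on_dense[OF A_completionD(3)[OF c]])
qed

text \<open>The extension is the closure of the graph \<open>{(J x, J T x)}\<close>.\<close>

lemma induced_op_exists:
  fixes J :: "'a::complex_hilbert \<Rightarrow>\<^sub>L 'k::complex_hilbert"
  assumes c: "is_A_completion A J" and T: "T \<in> A_adjointable A"
  shows "\<exists>F\<in>bounded_ops. \<forall>x. blinfun_apply F (J x) = J (T x)"
proof -
  have Tb: "T \<in> bounded_ops" using T by (simp add: A_adjointable_def)
  note J = A_completionD(1)[OF c]
  obtain C where C: "C \<ge> 0" "\<And>x. norm (J (T x)) \<le> C * norm (J x)"
    using A_adjointable_bounded[OF c T] by blast
  define G0 where "G0 = range (\<lambda>x. (J x, J (T x)))"
  define G where "G = closure G0"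
  have G0_add: "a + b \<in> G0" if ab: "a \<in> G0" "b \<in> G0" for a b
  proof -
    obtain x y where "a = (J x, J (T x))" "b = (J y, J (T y))" using ab unfolding G0_def by blast
    then show ?thesis
      unfolding G0_def by (intro range_eqI[of _ _ "x + y"]) (simp add: blinfun.add_right)
  qed
  have G0_scale: "k *\<^sub>C a \<in> G0" if ab: "a \<in> G0" for a k
  proof -
    obtain x where "a = (J x, J (T x))" using ab unfolding G0_def by blast
    then show ?thesis
      unfolding G0_def scaleC_prod_def
      by (intro range_eqI[of _ _ "k *\<^sub>C x"]) (simp add: bounded_opsD[OF J] bounded_opsD[OF Tb])
  qed
  have add: "a + b \<in> G" if "a \<in> G" "b \<in> G" for a b
    using closure_complex_subspace(1)[of G0] G0_add G0_scale that unfolding G_def by blast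
  have scale: "k *\<^sub>C a \<in> G" if "a \<in> G" for a k
    using closure_complex_subspace(2)[of G0] G0_add G0_scale that unfolding G_def by blast
  \<comment> \<open>The estimate passes to the closure; at z = 0 it shows that the closed graph is
    single-valued.\<close>
  have "G \<subseteq> {p. norm (snd p) \<le> C * norm (fst p)}"
    unfolding G_def using C(2)
    by (intro closure_minimal closed_Collect_le continuous_intros) (auto simp: G0_def)
  then have bound: "norm w \<le> C * norm z" if "(z, w) \<in> G" for z w using that by auto
  \<comment> \<open>Density gives J (x n) tending to \<open>z\<close>, and the estimate makes J (T
    (x n)) Cauchy, so every \<open>z\<close> lies in the domain.\<close>
  have "\<exists>w. (z, w) \<in> G" for z
  proof -
    have "z \<in> closure (range (blinfun_apply J))" using A_completionD(3)[OF c] by simp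
    then obtain f where f: "\<And>n. f n \<in> range (blinfun_apply J)" "f \<longlonglongrightarrow> z"
      unfolding closure_sequential by blast
    then have "\<forall>n. \<exists>x. f n = J x" by blast
    then obtain x where x: "\<And>n. f n = J (x n)" by metis
    have "Cauchy (\<lambda>n. J (T (x n)))"
    proof (rule metric_CauchyI)
      fix e :: real assume "e > 0"
      \<comment> \<open>Dividing by C + 1 covers C = 0.\<close>
      then have e: "e / (C + 1) > 0" using C(1) by simp
      have "Cauchy f" using f(2) by (rule LIMSEQ_imp_Cauchy)
      then obtain N where N: "\<And>m n. m \<ge> N \<Longrightarrow> n \<ge> N \<Longrightarrow> dist (f m) (f n) < e / (C + 1)"
        using metric_CauchyD[OF _ e] by blast
      have "dist (J (T (x m))) (J (T (x n))) < e" if "m \<ge> N" "n \<ge> N" for m n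
      proof -
        have "dist (J (T (x m))) (J (T (x n))) \<le> C * dist (f m) (f n)"
          using C(2)[of "x m - x n"] by (simp add: dist_norm x blinfun.diff_right)
        also have "\<dots> \<le> (C + 1) * dist (f m) (f n)" by (intro mult_right_mono) auto
        also have "\<dots> < e" using N[OF that] C(1) by (simp add: field_simps)
        finally show ?thesis .
      qed
      then show "\<exists>N. \<forall>m\<ge>N. \<forall>n\<ge>N. dist (J (T (x m))) (J (T (x n))) < e" by blast
    qed
    then obtain w where w: "(\<lambda>n. J (T (x n))) \<longlonglongrightarrow> w"
      using Cauchy_convergent_iff convergent_def by blast
    have "(\<lambda>n. (J (x n), J (T (x n)))) \<longlonglongrightarrow> (z, w)"
      using tendsto_Pair[OF f(2) w] by (simp add: x)
    then have "(z, w) \<in> G"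
      unfolding G_def closure_sequential
      by (intro exI[of _ "\<lambda>n. (J (x n), J (T (x n)))"]) (simp add: G0_def)
    then show ?thesis ..
  qed
  then obtain F where F: "\<And>z. (z, F z) \<in> G" by metis
  have eqI: "F z = w" if "(z, w) \<in> G" for z w
  proof -
    have "(z, F z) + (-1) *\<^sub>C (z, w) \<in> G" using that F by (intro add scale)
    then have "(0, F z - w) \<in> G" by (simp add: scaleC_prod_def scaleC_minus1)
    then show ?thesis using bound by fastforce
  qed
  have scaleF: "F (k *\<^sub>C z) = k *\<^sub>C F z" for k z
    using scale[OF F, of k z] by (intro eqI) (simp add: scaleC_prod_def)
  have bl: "bounded_linear F"
  proof (rule bounded_linear_intro)
    show "F (x + y) = F x + F y" for x y
      using add[OF F F, of x y] by (intro eqI) simp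
    show "F (r *\<^sub>R x) = r *\<^sub>R F x" for r x by (simp add: scaleR_scaleC scaleF)
    show "norm (F x) \<le> norm x * C" for x using bound[OF F, of x] by (simp add: mult.commute)
  qed
  have "F (J x) = J (T x)" for x
    using closure_subset[of G0] by (intro eqI) (auto simp: G_def G0_def)
  then show ?thesis
    by (intro bexI[of _ "Blinfun F"])
      (auto simp: bounded_linear_Blinfun_apply[OF bl] bounded_ops_def scaleF)
qed

lemma induced_op_works:
  assumes c: "is_A_completion A J" and T: "T \<in> A_adjointable A"
  shows "induced_op J T \<in> bounded_ops" and "blinfun_apply (induced_op J T) (J x) = J (T x)"
  using induced_op_exists[OF c T] induced_op_eqI[OF c] by metis+

text \<open>This is where the sharp operation becomes a Hilbert space adjoint. The difference of the
  two sides is orthogonal to the dense range of \<open>J\<close>, hence to itself.\<close>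

lemma adjoint_induced_op:
  assumes A: "A \<in> bounded_ops" and c: "is_A_completion A J" and T: "T \<in> A_adjointable A"
  shows "adjoint_op (induced_op J T) (J x) = J (A_sharp A T x)"
proof -
  have Tb: "T \<in> bounded_ops" using T by (simp add: A_adjointable_def)
  note ind = induced_op_works[OF c T]
  note sharp = A_sharp_works[OF A A_completion_symmetric[OF c] T]
  let ?w = "adjoint_op (induced_op J T) (J x) - J (A_sharp A T x)"
  have "range (blinfun_apply J) \<subseteq> {z. cinner ?w z = 0}"
    by (auto simp: cinner_algebra adjoint_op_left[OF ind(1)] ind(2) A_adjoint_inner[OF c Tb sharp(2)])
  then have "closure (range (blinfun_apply J)) \<subseteq> {z. cinner ?w z = 0}"
    by (intro closure_minimal closed_Collect_eq continuous_intros)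
  then have "?w \<in> {z. cinner ?w z = 0}"
    unfolding A_completionD(3)[OF c] by (rule subsetD) simp
  then show ?thesis by simp
qed

section \<open>Positive functionals on polynomials\<close>

text \<open>Both quantities are products of \<open>j\<close> factors of modulus at most 1, namely (k
  - i) / (n - i) and k / n, so their distance is at most the sum of the factorwise
  distances.\<close>

lemma binomial_quotient_bound:
  fixes j k n d :: nat
  assumes "k \<le> n" and "j \<le> d" and "2 * d < n"
  shows "\<bar>real (k choose j) / real (n choose j) - (real k / real n) ^ j\<bar> \<le> real d * (real d / (real n - real d))"
proof -
  define z where "z i = (real k - real i) / (real n - real i)" for i :: nat
  have quot: "real (k choose j) / real (n choose j) = (\<Prod>i=0..<j. z i)"
    unfolding binomial_gbinomial gbinomial_prod_rev z_def prod_dividef by simp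
  have pow: "(real k / real n) ^ j = (\<Prod>i=0..<j. real k / real n)" by simp
  have diff: "norm (z i - real k / real n) \<le> real d / (real n - real d)" if "i \<in> {0..<j}" for i
  proof -
    have i: "i < d" using that assms by simp
    have "z i - real k / real n = - (real i / (real n - real i)) * ((real n - real k) / real n)"
      using i assms by (simp add: z_def field_simps)
    then have "norm (z i - real k / real n) = (real i / (real n - real i)) * ((real n - real k) / real n)"
      using i assms by (simp add: abs_mult)
    also have "\<dots> \<le> (real i / (real n - real i)) * 1"
      using i assms by (intro mult_left_mono) (auto simp: field_simps)
    also have "\<dots> \<le> real d / (real n - real d)"
      using i assms by (simp, intro frac_le) auto
    finally show ?thesis .
  qed
  have "norm ((\<Prod>i=0..<j. z i) - (\<Prod>i=0..<j. real k / real n))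
      \<le> (\<Sum>i=0..<j. norm (z i - real k / real n))"
  proof (rule norm_prod_diff)
    fix i assume "i \<in> {0..<j}"
    then have i: "i < d" using assms by simp
    \<comment> \<open>For k < i the factor is negative; 2 d < n keeps it above -1.\<close>
    then show "norm (z i) \<le> 1" using assms by (auto simp: z_def abs_le_iff field_simps)
    show "norm (real k / real n) \<le> 1" using assms by (simp add: field_simps)
  qed
  also have "\<dots> \<le> (\<Sum>i=0..<j. real d / (real n - real d))" by (rule sum_mono) (rule diff)
  also have "\<dots> \<le> real d * (real d / (real n - real d))"
    using assms by (auto intro!: mult_right_mono divide_right_mono)
  finally show ?thesis unfolding quot pow by simp
qed

definition bernstein_poly :: "nat \<Rightarrow> nat \<Rightarrow> real poly" where
  "bernstein_poly n k = smult (real (n choose k)) ([:0, 1:] ^ k * [:1, -1:] ^ (n - k))"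

text \<open>Multiply X^j by (X + (1 - X))^(n - j) = 1, expand, and use C(n, j) C(n - j, k - j) =
  C(k, j) C(n, k). The terms with k < j vanish.\<close>

lemma power_bernstein_expansion:
  assumes "j \<le> n"
  shows "smult (real (n choose j)) ([:0, 1:] ^ j)
    = (\<Sum>k\<le>n. smult (real (k choose j)) (bernstein_poly n k))"
proof -
  let ?X = "[:0, 1:] :: real poly" and ?Y = "[:1, -1:] :: real poly"
  have smult_sum: "smult c (\<Sum>i\<in>I. f i) = (\<Sum>i\<in>I. smult c (f i))"
    for c :: real and f and I :: "nat set"
    by (induction I rule: infinite_finite_induct) (auto simp: smult_add_right)
  have "?X + ?Y = 1" by (simp add: one_pCons)
  then have "smult (real (n choose j)) (?X ^ j) = smult (real (n choose j)) (?X ^ j * (?X + ?Y) ^ (n - j))"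
    by (simp only: power_one mult_1_right)
  also have "\<dots> = (\<Sum>i\<le>n - j. smult (real (n choose j) * real (n - j choose i)) (?X ^ (i + j) * ?Y ^ (n - j - i)))"
    unfolding binomial_ring
    by (simp add: sum_distrib_left smult_sum power_add of_nat_poly mult_ac)
  also have "\<dots> = (\<Sum>k=j..n. smult (real (n choose j) * real (n - j choose (k - j))) (?X ^ k * ?Y ^ (n - k)))"
    by (rule sum.reindex_bij_witness[of _ "\<lambda>k. k - j" "\<lambda>i. i + j"]) (use assms in \<open>auto simp: add.commute\<close>)
  also have "\<dots> = (\<Sum>k=j..n. smult (real (k choose j)) (bernstein_poly n k))"
  proof (rule sum.cong[OF refl])
    fix k assume "k \<in> {j..n}"
    then have "real (n choose j) * real (n - j choose (k - j)) = real (k choose j) * real (n choose k)"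
      using choose_mult[of j k n] by (metis atLeastAtMost_iff mult.commute of_nat_mult)
    then show "smult (real (n choose j) * real (n - j choose (k - j))) (?X ^ k * ?Y ^ (n - k))
        = smult (real (k choose j)) (bernstein_poly n k)"
      by (simp add: bernstein_poly_def)
  qed
  also have "\<dots> = (\<Sum>k\<le>n. smult (real (k choose j)) (bernstein_poly n k))"
    by (rule sum.mono_neutral_left) (auto simp: binomial_eq_0)
  finally show ?thesis .
qed

text \<open>The Bernstein coefficients of degree \<open>n\<close> of a fixed \<open>p\<close> differ from the values \<open>p (k / n)\<close> by
  \<open>O(1 / n)\<close>, so they are almost nonnegative if \<open>p\<close> is nonnegative on the unit interval.\<close>

lemma positive_functional_unit_interval:
  fixes L :: "real poly \<Rightarrow> real"
  assumes add: "\<And>p q. L (p + q) = L p + L q" and scale: "\<And>c p. L (smult c p) = c * L p"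
    and pos: "\<And>k l. L ([:0, 1:] ^ k * [:1, -1:] ^ l) \<ge> 0"
    and p: "\<And>t. 0 \<le> t \<Longrightarrow> t \<le> 1 \<Longrightarrow> poly p t \<ge> 0"
  shows "L p \<ge> 0"
proof -
  have L0: "L 0 = 0" using scale[of 0 0] by simp
  have Lsum: "L (\<Sum>i\<in>I. f i) = (\<Sum>i\<in>I. L (f i))" for f :: "nat \<Rightarrow> real poly" and I
    by (induction I rule: infinite_finite_induct) (auto simp: L0 add)
  define d where "d = degree p"
  define c where "c = coeff p"
  define C where "C = (\<Sum>j\<le>d. \<bar>c j\<bar>)"
  have p_eq: "p = (\<Sum>j\<le>d. smult (c j) ([:0, 1:] ^ j))"
    unfolding d_def c_def by (subst poly_as_sum_of_monoms[symmetric]) (simp add: monom_altdef)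
  have bound: "L p \<ge> - (C * (real d * (real d / (real n - real d))) * L 1)" if n: "2 * d < n" for n
  proof -
    define e where "e = real d * (real d / (real n - real d))"
    define b where "b k = L (bernstein_poly n k)" for k
    \<comment> \<open>The Bernstein coefficient of X^j, which is close to (k / n)^j.\<close>
    define w where "w j k = real (k choose j) / real (n choose j)" for j k
    have b0: "b k \<ge> 0" for k by (simp add: b_def bernstein_poly_def scale pos)
    have Lpow: "L ([:0, 1:] ^ j) = (\<Sum>k\<le>n. w j k * b k)" if "j \<le> d" for j
    proof -
      have "n choose j > 0" using n that by simp
      moreover have "real (n choose j) * L ([:0, 1:] ^ j) = (\<Sum>k\<le>n. real (k choose j) * b k)"
        using arg_cong[OF power_bernstein_expansion[of j n], of L] n that
        by (simp add: scale Lsum b_def)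
      ultimately show ?thesis
        by (simp add: w_def field_simps flip: sum_divide_distrib)
    qed
    \<comment> \<open>Case j = 0: the Bernstein polynomials sum to 1.\<close>
    have sum_b: "(\<Sum>k\<le>n. b k) = L 1" using Lpow[of 0] by (simp add: w_def)
    have coef: "(\<Sum>j\<le>d. c j * w j k) \<ge> - (C * e)" if k: "k \<le> n" for k
    proof -
      have "poly p (real k / real n) \<ge> 0" using k n by (intro p) (auto simp: field_simps)
      moreover have "poly p (real k / real n) = (\<Sum>j\<le>d. c j * (real k / real n) ^ j)"
        by (simp add: poly_altdef d_def c_def)
      moreover have "\<bar>(\<Sum>j\<le>d. c j * w j k) - (\<Sum>j\<le>d. c j * (real k / real n) ^ j)\<bar> \<le> C * e"
      proof -
        have "\<bar>(\<Sum>j\<le>d. c j * w j k) - (\<Sum>j\<le>d. c j * (real k / real n) ^ j)\<bar>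
            = \<bar>\<Sum>j\<le>d. c j * (w j k - (real k / real n) ^ j)\<bar>"
          by (simp add: sum_subtractf right_diff_distrib)
        also have "\<dots> \<le> (\<Sum>j\<le>d. \<bar>c j\<bar> * \<bar>w j k - (real k / real n) ^ j\<bar>)"
          by (rule order_trans[OF sum_abs]) (simp add: abs_mult)
        also have "\<dots> \<le> (\<Sum>j\<le>d. \<bar>c j\<bar> * e)"
          unfolding w_def e_def using binomial_quotient_bound[OF k _ n]
          by (intro sum_mono mult_left_mono) auto
        finally show ?thesis by (simp add: C_def sum_distrib_right)
      qed
      ultimately show ?thesis by linarith
    qed
    have "L p = (\<Sum>j\<le>d. c j * (\<Sum>k\<le>n. w j k * b k))"
      by (subst p_eq) (simp add: Lsum scale Lpow)
    also have "\<dots> = (\<Sum>k\<le>n. (\<Sum>j\<le>d. c j * w j k) * b k)"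
      unfolding sum_distrib_left sum_distrib_right
      by (subst sum.swap) (simp add: mult.assoc)
    also have "\<dots> \<ge> (\<Sum>k\<le>n. - (C * e) * b k)"
      by (intro sum_mono mult_right_mono coef b0) auto
    also have "(\<Sum>k\<le>n. - (C * e) * b k) = - (C * e * L 1)"
      unfolding sum_distrib_left[symmetric] sum_b by simp
    finally show ?thesis unfolding e_def .
  qed
  have "(\<lambda>m. (C * real d * real d * L 1) / real m) \<longlonglongrightarrow> 0" by (rule lim_const_over_n)
  then have "(\<lambda>m. - ((C * real d * real d * L 1) / real m)) \<longlonglongrightarrow> 0"
    using tendsto_minus by fastforce
  then show ?thesis
  proof (rule LIMSEQ_le_const2)
    show "\<exists>N. \<forall>m\<ge>N. - ((C * real d * real d * L 1) / real m) \<le> L p"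
    proof (intro exI allI impI)
      \<comment> \<open>Degree n = d + m makes the denominator n - d equal to \<open>m\<close>, and
        m > d ensures 2 d < n.\<close>
      fix m assume "m \<ge> Suc d"
      then show "- ((C * real d * real d * L 1) / real m) \<le> L p"
        using bound[of "d + m"] by (simp add: mult_ac)
    qed
  qed
qed

text \<open>Substituting X / M reduces to the unit interval: 1 - X becomes (M - X) / M, so the test
  products only pick up positive constants.\<close>

lemma positive_functional_interval:
  fixes L :: "real poly \<Rightarrow> real"
  assumes add: "\<And>p q. L (p + q) = L p + L q" and scale: "\<And>c p. L (smult c p) = c * L p"
    and M: "M > 0"
    and pos: "\<And>k l. L ([:0, 1:] ^ k * [:M, -1:] ^ l) \<ge> 0"
    and p: "\<And>t. 0 \<le> t \<Longrightarrow> t \<le> M \<Longrightarrow> poly p t \<ge> 0"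
  shows "L p \<ge> 0"
proof -
  define L' where "L' q = L (pcompose q [:0, 1/M:])" for q
  have "L' (pcompose p [:0, M:]) \<ge> 0"
  proof (rule positive_functional_unit_interval)
    fix k l :: nat
    have X: "pcompose [:0, 1:] [:0, 1/M:] = smult (1/M) [:0, 1:]" by (simp add: pcompose_pCons)
    have Y: "pcompose [:1, -1:] [:0, 1/M:] = smult (1/M) [:M, -1:]"
      using M by (simp add: pcompose_pCons)
    have pw: "pcompose (q ^ i) r = (pcompose q r) ^ i" for q r :: "real poly" and i
      by (induction i) (auto simp: pcompose_mult pcompose_1)
    have "L' ([:0, 1:] ^ k * [:1, -1:] ^ l) = (1/M) ^ k * (1/M) ^ l * L ([:0, 1:] ^ k * [:M, -1:] ^ l)"
      unfolding L'_def pcompose_mult pw X Y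
      by (simp only: smult_power mult_smult_left mult_smult_right smult_smult scale)
        (simp add: scale mult_ac)
    also have "\<dots> \<ge> 0" using M pos[of k l] by (intro mult_nonneg_nonneg) auto
    finally show "L' ([:0, 1:] ^ k * [:1, -1:] ^ l) \<ge> 0" .
  next
    fix t :: real assume "0 \<le> t" "t \<le> 1"
    then show "0 \<le> poly (pcompose p [:0, M:]) t"
      using M by (auto simp: poly_pcompose mult_left_le mult.commute intro!: p)
  qed (auto simp: L'_def pcompose_add pcompose_smult add scale)
  moreover have "pcompose (pcompose p [:0, M:]) [:0, 1/M:] = p"
    using M by (simp add: pcompose_assoc[symmetric] pcompose_pCons)
  ultimately show ?thesis by (simp add: L'_def)
qed

section \<open>Polynomials in an operator\<close>

lemma poly_op_alt:
  assumes "degree p \<le> n"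
  shows "poly_op p S = (\<Sum>i\<le>n. coeff p i *\<^sub>R ((\<lambda>F. S o\<^sub>L F) ^^ i) id_blinfun)"
  unfolding poly_op_def
  by (rule sum.mono_neutral_left) (use assms in \<open>auto simp: coeff_eq_0\<close>)

lemma poly_op_0 [simp]: "poly_op 0 S = 0"
  by (simp add: poly_op_def)

text \<open>Horner's recursion, from which the algebraic rules for \<open>poly_op\<close> follow by
  induction on the coefficients.\<close>

lemma poly_op_pCons: "poly_op (pCons a p) S = a *\<^sub>R id_blinfun + (S o\<^sub>L poly_op p S)"
proof -
  have "degree (pCons a p) \<le> Suc (degree p)" by (rule degree_pCons_le)
  then have "poly_op (pCons a p) S = a *\<^sub>R id_blinfun +
      (\<Sum>i\<le>degree p. coeff p i *\<^sub>R (S o\<^sub>L ((\<lambda>F. S o\<^sub>L F) ^^ i) id_blinfun))"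
    by (subst poly_op_alt, assumption) (simp add: sum.atMost_Suc_shift del: sum.atMost_Suc)
  also have "(\<Sum>i\<le>degree p. coeff p i *\<^sub>R (S o\<^sub>L ((\<lambda>F. S o\<^sub>L F) ^^ i) id_blinfun)) = S o\<^sub>L poly_op p S"
    unfolding poly_op_def
    by (simp add: bounded_bilinear.sum_right[OF bounded_bilinear_blinfun_compose]
        bounded_bilinear.scaleR_right[OF bounded_bilinear_blinfun_compose])
  finally show ?thesis .
qed

lemma poly_op_pCons_apply:
  "poly_op (pCons a p) S x = a *\<^sub>R x + S (blinfun_apply (poly_op p S) x)"
  by (simp add: poly_op_pCons blinfun.add_left blinfun.scaleR_left)

lemma poly_op_const_apply: "blinfun_apply (poly_op [:a:] S) x = a *\<^sub>R x"
  by (simp add: poly_op_pCons_apply)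

lemma poly_op_add: "poly_op (p + q) S = poly_op p S + poly_op q S"
proof (induction p q rule: poly_induct2)
  case (pCons a p b q)
  then show ?case
    by (intro blinfun_eqI)
      (simp add: poly_op_pCons_apply blinfun.add_left blinfun.add_right scaleR_add_left add_ac)
qed simp

lemma poly_op_smult: "poly_op (smult c p) S = c *\<^sub>R poly_op p S"
proof (induction p)
  case (pCons a p)
  then show ?case
    by (intro blinfun_eqI)
      (simp add: poly_op_pCons_apply blinfun.scaleR_left blinfun.scaleR_right scaleR_add_right)
qed simp

lemma poly_op_diff: "poly_op (p - q) S = poly_op p S - poly_op q S"
  using poly_op_add[of p "- q" S] poly_op_smult[of "-1" q S] by simp

lemma poly_op_mult_apply:
  "blinfun_apply (poly_op (p * q) S) x = poly_op p S (blinfun_apply (poly_op q S) x)"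
proof (induction p)
  case (pCons a p)
  then show ?case
    by (simp add: poly_op_add poly_op_smult blinfun.add_left blinfun.scaleR_left
        poly_op_pCons_apply)
qed simp

section \<open>Positivity and norm of p(S) for positive \<open>S\<close>\<close>

lemma poly_op_symmetric:
  fixes S :: "'a::complex_hilbert \<Rightarrow>\<^sub>L 'a"
  assumes sym: "\<And>x y. cinner (S x) y = cinner x (S y)"
  shows "cinner (poly_op p S x) y = cinner x (poly_op p S y)"
proof (induction p arbitrary: x y)
  case (pCons a p)
  have comm: "S (poly_op p S y) = poly_op p S (S y)"
    using poly_op_mult_apply[of "[:0, 1:]" p S y] poly_op_mult_apply[of p "[:0, 1:]" S y]
    by (simp add: poly_op_pCons_apply mult.commute del: mult_pCons_left mult_pCons_right)
  show ?case
    by (simp add: poly_op_pCons_apply cinner_add_left cinner_add_right cinner_scaleR_left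
        cinner_scaleR_right sym pCons comm)
qed simp

text \<open>Squares move onto the vector because polynomials in \<open>S\<close> are symmetric,
  which leaves the four cases 1, S, M - S and S (M - S). This is the positivity hypothesis of the
  Bernstein argument.\<close>

lemma poly_op_bernstein_nonneg:
  fixes S :: "'a::complex_hilbert \<Rightarrow>\<^sub>L 'a"
  assumes sym: "\<And>x y. cinner (S x) y = cinner x (S y)"
    and pos: "\<And>x. Re (cinner (S x) x) \<ge> 0" and M: "M = norm S" "M > 0"
  shows "Re (cinner (poly_op ([:0, 1:] ^ k * [:M, -1:] ^ l) S x) x) \<ge> 0"
proof -
  let ?X = "[:0, 1:] :: real poly" and ?Y = "[:M, -1:] :: real poly"
  let ?E = "\<lambda>p. blinfun_apply (poly_op p S)"
  let ?Q = "\<lambda>p x. Re (cinner (?E p x) x)"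
  have EX: "?E ?X x = S x" for x by (simp add: poly_op_pCons_apply)
  have EY: "?E ?Y x = M *\<^sub>R x - S x" for x by (simp add: poly_op_pCons_apply blinfun.minus_right)
  have posX: "?Q ?X x \<ge> 0" for x by (simp only: EX pos)
  have posY: "?Q ?Y x \<ge> 0" for x
  proof -
    have "Re (cinner (S x) x) \<le> cmod (cinner (S x) x)" by (rule complex_Re_le_cmod)
    also have "\<dots> \<le> norm (S x) * norm x" by (rule cinner_Cauchy_Schwarz)
    also have "\<dots> \<le> (M * norm x) * norm x" unfolding M by (intro mult_right_mono norm_blinfun) auto
    finally show ?thesis
      unfolding EY by (simp add: cinner_algebra cinner_scaleR_left cinner_norm power2_eq_square)
  qed
  have sq: "?Q (q * q * p) x = ?Q p (?E q x)" for p q x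
    using poly_op_symmetric[OF sym, of q "?E (q * p) x" x]
      poly_op_mult_apply[of q "q * p" S x] poly_op_mult_apply[of p q S x]
    by (simp add: mult.assoc mult.commute[of q p])
  have Qadd: "?Q (p + q) x = ?Q p x + ?Q q x" for p q x
    by (simp add: poly_op_add blinfun.add_left cinner_add_left)
  have Qsmult: "?Q (smult c p) x = c * ?Q p x" for c p x
    by (simp add: poly_op_smult blinfun.scaleR_left cinner_scaleR_left)
  have posXY: "?Q (?X * ?Y) x \<ge> 0" for x
  proof -
    \<comment> \<open>Since X + Y = M, the product M X Y is X X Y + Y Y X, and each summand is a
      square times a factor already known to be positive.\<close>
    have "smult M (?X * ?Y) = ?X * ?X * ?Y + ?Y * ?Y * ?X"
      by (simp add: algebra_simps)
    then have "M * ?Q (?X * ?Y) x = ?Q ?Y (?E ?X x) + ?Q ?X (?E ?Y x)"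
      using Qsmult[of M "?X * ?Y" x] by (simp only: Qadd sq)
    also have "\<dots> \<ge> 0" by (intro add_nonneg_nonneg posX posY)
    finally show ?thesis using M by (simp add: zero_le_mult_iff)
  qed
  have "?Q (?X ^ k * ?Y ^ l) x \<ge> 0"
  proof (induction "k + l" arbitrary: k l x rule: less_induct)
    case less
    consider k' where "k = Suc (Suc k')" | l' where "l = Suc (Suc l')" | "k \<in> {0, 1}" "l \<in> {0, 1}"
      by (metis One_nat_def insertCI not0_implies_Suc)
    then show ?case
    proof cases
      case 1
      then have "?X ^ k * ?Y ^ l = ?X * ?X * (?X ^ k' * ?Y ^ l)" by (simp only: power_Suc mult_ac)
      then show ?thesis using less[of k' l] 1 by (simp only: sq)
    next
      case 2
      then have "?X ^ k * ?Y ^ l = ?Y * ?Y * (?X ^ k * ?Y ^ l')" by (simp only: power_Suc mult_ac)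
      then show ?thesis using less[of k l'] 2 by (simp only: sq)
    next
      case 3
      have "?Q 1 x \<ge> 0" by (simp add: one_pCons poly_op_const_apply cinner_norm)
      then show ?thesis
        using 3 posX[of x] posY[of x] posXY[of x] by (elim insertE emptyE) (simp_all only: power_0 power_one_right mult_1 mult_1_right)
    qed
  qed
  then show ?thesis .
qed

text \<open>The functional p \<mapsto> Re <p(S) x, x> satisfies the hypotheses of the Bernstein
  criterion on [0, ||S||]. For S = 0 the interval degenerates and only the constant term
  remains.\<close>

lemma poly_op_nonneg:
  fixes S :: "'a::complex_hilbert \<Rightarrow>\<^sub>L 'a"
  assumes sym: "\<And>x y. cinner (S x) y = cinner x (S y)"
    and pos: "\<And>x. Re (cinner (S x) x) \<ge> 0"
    and p: "\<And>t. 0 \<le> t \<Longrightarrow> t \<le> norm S \<Longrightarrow> poly p t \<ge> 0"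
  shows "Re (cinner (poly_op p S x) x) \<ge> 0"
proof (cases "norm S = 0")
  case True
  then have "S = 0" by simp
  obtain a q where pq: "p = pCons a q" by (rule pCons_cases)
  have "a \<ge> 0" using p[of 0] True by (simp add: pq)
  then show ?thesis
    by (simp add: pq poly_op_pCons_apply \<open>S = 0\<close> cinner_scaleR_left cinner_norm)
next
  case False
  then have M: "norm S > 0" by simp
  show ?thesis
  proof (rule positive_functional_interval[where L = "\<lambda>p. Re (cinner (poly_op p S x) x)" and M = "norm S"])
    show "0 \<le> Re (cinner (poly_op ([:0, 1:] ^ k * [:norm S, -1:] ^ l) S x) x)" for k l
      by (rule poly_op_bernstein_nonneg[OF sym pos refl M])
  qed (use M in \<open>auto simp: p poly_op_add poly_op_smult blinfun.add_left blinfun.scaleR_left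
      cinner_add_left cinner_scaleR_left\<close>)
qed

text \<open>Positivity applied to c^2 - p^2 gives ||p(S) x||^2 \<le> c^2 ||x||^2, since p(S) is
  symmetric.\<close>

lemma norm_poly_op_le:
  fixes S :: "'a::complex_hilbert \<Rightarrow>\<^sub>L 'a"
  assumes sym: "\<And>x y. cinner (S x) y = cinner x (S y)"
    and pos: "\<And>x. Re (cinner (S x) x) \<ge> 0"
    and c: "c \<ge> 0" and p: "\<And>t. 0 \<le> t \<Longrightarrow> t \<le> norm S \<Longrightarrow> \<bar>poly p t\<bar> \<le> c"
  shows "norm (poly_op p S) \<le> c"
proof (rule norm_blinfun_bound[OF c])
  fix x
  have "poly ([:c\<^sup>2:] - p * p) t \<ge> 0" if "0 \<le> t" "t \<le> norm S" for t
    using power_mono[OF p[OF that], of 2] by (simp add: power2_eq_square)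
  then have "Re (cinner (poly_op ([:c\<^sup>2:] - p * p) S x) x) \<ge> 0"
    by (rule poly_op_nonneg[OF sym pos])
  then have "(norm (poly_op p S x))\<^sup>2 \<le> (c * norm x)\<^sup>2"
    by (simp add: poly_op_diff blinfun.diff_left cinner_diff_left poly_op_const_apply
        cinner_scaleR_left poly_op_mult_apply poly_op_symmetric[OF sym, of p "poly_op p S x"]
        cinner_norm power_mult_distrib)
  then show "norm (poly_op p S x) \<le> c * norm x"
    by (rule power2_le_imp_le) (use c in simp)
qed

section \<open>Real powers\<close>

lemma polynomial_uniform_approximation:
  fixes f :: "real \<Rightarrow> real"
  assumes "continuous_on {0..M} f"
  shows "\<exists>p :: nat \<Rightarrow> real poly. uniform_limit {0..M} (\<lambda>n t. poly (p n) t) f sequentially"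
proof -
  have "\<exists>q. \<forall>t\<in>{0..M}. \<bar>f t - poly q t\<bar> < 1 / real (Suc n)" for n
  proof -
    obtain g where g: "real_polynomial_function g" "\<And>t. t \<in> {0..M} \<Longrightarrow> \<bar>f t - g t\<bar> < 1 / real (Suc n)"
      using Stone_Weierstrass_real_polynomial_function[OF compact_Icc assms, of "1 / real (Suc n)"]
      by auto
    obtain a m where "g = (\<lambda>t. \<Sum>i\<le>m. a i * t ^ i)"
      using g(1) unfolding real_polynomial_function_iff_sum by blast
    then have "poly (\<Sum>i\<le>m. monom (a i) i) t = g t" for t by (simp add: poly_sum poly_monom)
    then show ?thesis
      using g(2) by (intro exI[of _ "\<Sum>i\<le>m. monom (a i) i"]) simp
  qed
  then obtain p where p: "\<And>n t. t \<in> {0..M} \<Longrightarrow> \<bar>f t - poly (p n) t\<bar> < 1 / real (Suc n)" by metis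
  have "uniform_limit {0..M} (\<lambda>n t. poly (p n) t) f sequentially"
  proof (rule uniform_limitI)
    fix e :: real assume "e > 0"
    then obtain N where N: "1 / real (Suc N) < e" using nat_approx_posE by blast
    have "\<forall>t\<in>{0..M}. dist (poly (p n) t) (f t) < e" if "n \<ge> N" for n
    proof
      fix t assume "t \<in> {0..M}"
      then have "\<bar>f t - poly (p n) t\<bar> < 1 / real (Suc n)" by (rule p)
      also have "\<dots> \<le> 1 / real (Suc N)" using that by (intro divide_left_mono) auto
      finally show "dist (poly (p n) t) (f t) < e" using N by (simp add: dist_real_def abs_minus_commute)
    qed
    then show "\<forall>\<^sub>F n in sequentially. \<forall>t\<in>{0..M}. dist (poly (p n) t) (f t) < e"
      by (auto simp: eventually_sequentially)
  qed
  then show ?thesis by blast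
qed

text \<open>The norm bound applied to p m - q n. Taking q = p gives a Cauchy sequence; distinct
  sequences give independence of the limit.\<close>

lemma poly_op_uniform_close:
  fixes S :: "'a::complex_hilbert \<Rightarrow>\<^sub>L 'a" and p q :: "nat \<Rightarrow> real poly"
  assumes sym: "\<And>x y. cinner (S x) y = cinner x (S y)"
    and pos: "\<And>x. Re (cinner (S x) x) \<ge> 0"
    and p: "uniform_limit {0..norm S} (\<lambda>n t. poly (p n) t) f sequentially"
    and q: "uniform_limit {0..norm S} (\<lambda>n t. poly (q n) t) f sequentially" and e: "e > 0"
  shows "\<exists>N. \<forall>m\<ge>N. \<forall>n\<ge>N. norm (poly_op (p m) S - poly_op (q n) S) < e"
proof -
  have e2: "e / 3 > 0" using e by simp
  obtain N where N: "\<And>n t. n \<ge> N \<Longrightarrow> t \<in> {0..norm S} \<Longrightarrow> dist (poly (p n) t) (f t) < e / 3"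
    using uniform_limitD[OF p e2] unfolding eventually_sequentially by blast
  obtain N' where N': "\<And>n t. n \<ge> N' \<Longrightarrow> t \<in> {0..norm S} \<Longrightarrow> dist (poly (q n) t) (f t) < e / 3"
    using uniform_limitD[OF q e2] unfolding eventually_sequentially by blast
  have "norm (poly_op (p m) S - poly_op (q n) S) < e" if "m \<ge> max N N'" "n \<ge> max N N'" for m n
  proof -
    have "norm (poly_op (p m - q n) S) \<le> 2 * e / 3"
    proof (rule norm_poly_op_le[OF sym pos])
      fix t assume "0 \<le> t" "t \<le> norm S"
      then have "\<bar>poly (p m) t - f t\<bar> < e / 3" "\<bar>poly (q n) t - f t\<bar> < e / 3"
        using N[of m t] N'[of n t] that by (auto simp: dist_real_def)
      then have "\<bar>poly (p m) t - poly (q n) t\<bar> \<le> 2 * e / 3" by linarith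
      then show "\<bar>poly (p m - q n) t\<bar> \<le> 2 * e / 3" by simp
    qed (use e in simp)
    then show ?thesis using e by (simp add: poly_op_diff)
  qed
  then show ?thesis by blast
qed

text \<open>Justifies the definite description in \<open>powr_op\<close>: completeness gives a limit
  along \<open>p\<close>, and every other approximating sequence has the same limit.\<close>

lemma powr_op_tendsto:
  fixes S :: "'a::complex_hilbert \<Rightarrow>\<^sub>L 'a" and p :: "nat \<Rightarrow> real poly"
  assumes sym: "\<And>x y. cinner (S x) y = cinner x (S y)"
    and pos: "\<And>x. Re (cinner (S x) x) \<ge> 0" and r: "r > 0"
    and p: "uniform_limit {0..norm S} (\<lambda>n t. poly (p n) t) (\<lambda>t. t powr r) sequentially"
  shows "(\<lambda>n. poly_op (p n) S) \<longlonglongrightarrow> powr_op S r"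
proof -
  note close = poly_op_uniform_close[OF sym pos]
  have "Cauchy (\<lambda>n. poly_op (p n) S)"
  proof (rule metric_CauchyI)
    fix e :: real assume "e > 0"
    then show "\<exists>N. \<forall>m\<ge>N. \<forall>n\<ge>N. dist (poly_op (p m) S) (poly_op (p n) S) < e"
      unfolding dist_norm by (rule close[OF p p])
  qed
  then obtain R where R: "(\<lambda>n. poly_op (p n) S) \<longlonglongrightarrow> R"
    using Cauchy_convergent_iff convergent_def by blast
  have R': "(\<lambda>n. poly_op (q n) S) \<longlonglongrightarrow> R"
    if q: "uniform_limit {0..norm S} (\<lambda>n t. poly (q n) t) (\<lambda>t. t powr r) sequentially" for q
  proof -
    have "(\<lambda>n. poly_op (q n) S - poly_op (p n) S) \<longlonglongrightarrow> 0"
    proof (rule LIMSEQ_I)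
      fix e :: real assume "e > 0"
      then show "\<exists>N. \<forall>n\<ge>N. norm (poly_op (q n) S - poly_op (p n) S - 0) < e"
        unfolding diff_zero using close[OF q p] by blast
    qed
    then show ?thesis using tendsto_add[OF _ R] by fastforce
  qed
  have "powr_op S r = R"
    unfolding powr_op_def
  proof (rule the_equality)
    fix R2
    assume "\<forall>p::nat \<Rightarrow> real poly. uniform_limit {0..norm S} (\<lambda>n t. poly (p n) t) (\<lambda>t. t powr r) sequentially
      \<longrightarrow> (\<lambda>n. poly_op (p n) S) \<longlonglongrightarrow> R2"
    then show "R2 = R" using p R LIMSEQ_unique by blast
  qed (use R' in blast)
  then show ?thesis using R by simp
qed

text \<open>Up to a uniform error the approximating polynomials dominate the affine minorant on
  [0, ||S||], where positivity applies. Tangent lines as minorants yield McCarthy's inequality; a =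
  b = 0 yields positivity of S^r.\<close>

lemma powr_op_affine_lower_bound:
  fixes S :: "'a::complex_hilbert \<Rightarrow>\<^sub>L 'a"
  assumes sym: "\<And>x y. cinner (S x) y = cinner x (S y)"
    and pos: "\<And>x. Re (cinner (S x) x) \<ge> 0" and r: "r > 0"
    and ab: "\<And>t. 0 \<le> t \<Longrightarrow> a + b * t \<le> t powr r"
  shows "a * (norm x)\<^sup>2 + b * Re (cinner (S x) x) \<le> Re (cinner (powr_op S r x) x)"
proof -
  have "continuous_on {0..norm S} (\<lambda>t. t powr r)"
    using r by (intro continuous_on_powr' continuous_intros) auto
  then obtain p :: "nat \<Rightarrow> real poly"
    where p: "uniform_limit {0..norm S} (\<lambda>n t. poly (p n) t) (\<lambda>t. t powr r) sequentially"
    using polynomial_uniform_approximation by blast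
  have "(\<lambda>n. poly_op (p n) S) \<longlonglongrightarrow> powr_op S r" by (rule powr_op_tendsto[OF sym pos r p])
  then have lim: "(\<lambda>n. Re (cinner (poly_op (p n) S x) x)) \<longlonglongrightarrow> Re (cinner (powr_op S r x) x)"
    by (intro tendsto_intros)
  have "a * (norm x)\<^sup>2 + b * Re (cinner (S x) x) - e * (norm x)\<^sup>2 \<le> Re (cinner (powr_op S r x) x)"
    if "e > 0" for e
  proof (rule LIMSEQ_le_const[OF lim])
    obtain N where N: "\<And>n t. n \<ge> N \<Longrightarrow> t \<in> {0..norm S} \<Longrightarrow> dist (poly (p n) t) (t powr r) < e"
      using uniform_limitD[OF p \<open>e > 0\<close>] unfolding eventually_sequentially by blast
    have "a * (norm x)\<^sup>2 + b * Re (cinner (S x) x) - e * (norm x)\<^sup>2 \<le> Re (cinner (poly_op (p n) S x) x)"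
      if n: "n \<ge> N" for n
    proof -
      \<comment> \<open>Lowering the constant by \<open>e\<close> absorbs the uniform error of
        \<open>p n\<close>.\<close>
      have "Re (cinner (poly_op (p n - [:a - e, b:]) S x) x) \<ge> 0"
      proof (rule poly_op_nonneg[OF sym pos])
        fix t assume t: "0 \<le> t" "t \<le> norm S"
        have "a + b * t \<le> poly (p n) t + e"
          using N[OF n, of t] t ab[of t] by (simp add: dist_real_def abs_less_iff)
        then show "0 \<le> poly (p n - [:a - e, b:]) t" by (simp add: algebra_simps)
      qed
      then show ?thesis
        by (simp add: poly_op_diff blinfun.diff_left blinfun.scaleR_right poly_op_pCons_apply
            cinner_diff_left cinner_add_left cinner_scaleR_left cinner_norm algebra_simps)
    qed
    then show "\<exists>N. \<forall>n\<ge>N. a * (norm x)\<^sup>2 + b * Re (cinner (S x) x) - e * (norm x)\<^sup>2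
        \<le> Re (cinner (poly_op (p n) S x) x)" by blast
  qed
  note le = this
  show ?thesis
  proof (rule field_le_epsilon)
    fix e :: real assume "e > 0"
    \<comment> \<open>The added 1 covers x = 0.\<close>
    define e' where "e' = e / ((norm x)\<^sup>2 + 1)"
    have "(norm x)\<^sup>2 + 1 > 0" by (simp add: add_nonneg_pos)
    then have "e' > 0" "e' * (norm x)\<^sup>2 \<le> e" using \<open>e > 0\<close> by (auto simp: e'_def field_simps)
    then show "a * (norm x)\<^sup>2 + b * Re (cinner (S x) x) \<le> Re (cinner (powr_op S r x) x) + e"
      using le[of e'] by linarith
  qed
qed

section \<open>Scalar and operator inequalities\<close>

text \<open>Young's inequality with weights 1 / r and 1 - 1 / r bounds t s^(r - 1), the weighted
  geometric mean of t^r and s^r. The cases t = 0 and r = 1 are checked directly.\<close>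

lemma powr_tangent:
  fixes r s t :: real
  assumes r: "r \<ge> 1" and s: "s > 0" and t: "t \<ge> 0"
  shows "s powr r + r * s powr (r - 1) * (t - s) \<le> t powr r"
proof (cases "t = 0 \<or> r = 1")
  case True
  have "s * s powr (r - 1) = s powr r" using s by (simp add: powr_mult_base)
  moreover have "s powr r \<le> r * s powr r" using r by (simp add: mult_le_cancel_right1)
  ultimately show ?thesis using True s t r by (auto simp: algebra_simps)
next
  case False
  then have t: "t > 0" and r: "r > 1" using t r by auto
  have eq: "(t powr r) powr (1/r) * (s powr r) powr (1 - 1/r) = t * s powr (r - 1)"
    using s t r by (simp add: powr_powr right_diff_distrib)
  have "(t powr r) powr (1/r) * (s powr r) powr (1 - 1/r)
      \<le> (1/r) * t powr r + (1 - 1/r) * s powr r"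
    by (rule Youngs_inequality_0) (use r s t in \<open>auto simp: field_simps\<close>)
  then have "r * (t * s powr (r - 1)) \<le> r * ((1/r) * t powr r + (1 - 1/r) * s powr r)"
    unfolding eq using r by (intro mult_left_mono) auto
  also have "\<dots> = t powr r + r * s powr r - s powr r" using r by (simp add: field_simps)
  finally have "r * (t * s powr (r - 1)) \<le> t powr r + r * s powr r - s powr r" .
  moreover have "s * s powr (r - 1) = s powr r" using s by (simp add: powr_mult_base)
  ultimately show ?thesis by (simp add: algebra_simps)
qed

text \<open>Add the tangent inequalities at the midpoint s = (a + b) / 2, where the linear terms
  cancel.\<close>

lemma powr_add_le:
  fixes a b r :: real
  assumes r: "r \<ge> 1" and "a \<ge> 0" "b \<ge> 0"
  shows "(a + b) powr r \<le> 2 powr (r - 1) * (a powr r + b powr r)"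
proof (cases "a + b = 0")
  case True
  then show ?thesis using assms by simp
next
  case False
  define s where "s = (a + b) / 2"
  have s: "s > 0" using False assms by (simp add: s_def)
  have "2 * s powr r + r * s powr (r - 1) * (a + b - 2 * s) \<le> a powr r + b powr r"
    using powr_tangent[OF r s \<open>a \<ge> 0\<close>] powr_tangent[OF r s \<open>b \<ge> 0\<close>] by (simp add: algebra_simps)
  moreover have "a + b - 2 * s = 0" by (simp add: s_def)
  ultimately have "2 * s powr r \<le> a powr r + b powr r" by simp
  then have "2 powr (r - 1) * (2 * s powr r) \<le> 2 powr (r - 1) * (a powr r + b powr r)"
    by (intro mult_left_mono) auto
  moreover have "2 powr (r - 1) * (2 * s powr r) = (2 * s) powr r"
    using s by (simp add: powr_mult powr_mult_base mult.assoc[symmetric] mult.commute[of _ "2::real"])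
  moreover have "2 * s = a + b" by (simp add: s_def)
  ultimately show ?thesis by simp
qed

text \<open>Averaging the tangent line of \<open>t\<^sup>r\<close> at \<open>s = \<langle>P u, u\<rangle> + \<langle>Q v, v\<rangle>\<close>.\<close>

lemma McCarthy_pair:
  fixes P Q :: "'a::complex_hilbert \<Rightarrow>\<^sub>L 'a"
  assumes symP: "\<And>x y. cinner (P x) y = cinner x (P y)" and posP: "\<And>x. Re (cinner (P x) x) \<ge> 0"
    and symQ: "\<And>x y. cinner (Q x) y = cinner x (Q y)" and posQ: "\<And>x. Re (cinner (Q x) x) \<ge> 0"
    and r: "r \<ge> 1" and unit: "(norm u)\<^sup>2 + (norm v)\<^sup>2 = 1"
  shows "(Re (cinner (P u) u) + Re (cinner (Q v) v)) powr r
    \<le> Re (cinner (powr_op P r u) u) + Re (cinner (powr_op Q r v) v)"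
proof -
  define s where "s = Re (cinner (P u) u) + Re (cinner (Q v) v)"
  have r0: "r > 0" using r by simp
  have "s powr r \<le> Re (cinner (powr_op P r u) u) + Re (cinner (powr_op Q r v) v)"
  proof (cases "s = 0")
    case True
    \<comment> \<open>No tangent is available at s = 0; the zero minorant shows that the right side
      is nonnegative.\<close>
    then show ?thesis
      using powr_op_affine_lower_bound[OF symP posP r0, of 0 0 u]
        powr_op_affine_lower_bound[OF symQ posQ r0, of 0 0 v] by simp
  next
    case False
    then have s: "s > 0" using posP[of u] posQ[of v] unfolding s_def by linarith
    define b where "b = r * s powr (r - 1)"
    define a where "a = s powr r - b * s"
    have ab: "a + b * t \<le> t powr r" if "t \<ge> 0" for t
      using powr_tangent[OF r s that] by (simp add: a_def b_def algebra_simps)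
    have "a * (norm u)\<^sup>2 + b * Re (cinner (P u) u) + (a * (norm v)\<^sup>2 + b * Re (cinner (Q v) v))
        = a * ((norm u)\<^sup>2 + (norm v)\<^sup>2) + b * s"
      by (simp add: s_def algebra_simps)
    also have "\<dots> = s powr r" by (simp add: unit a_def)
    finally show ?thesis
      using powr_op_affine_lower_bound[OF symP posP r0 ab, of u]
        powr_op_affine_lower_bound[OF symQ posQ r0 ab, of v] by linarith
  qed
  then show ?thesis by (simp add: s_def)
qed

text \<open>The case \<open>\<alpha> = 2\<close> is Buzano's inequality.\<close>

lemma generalized_Buzano:
  fixes x y e :: "'a::complex_hilbert"
  assumes e: "norm e = 1"
  shows "cmod \<alpha> * cmod (cinner x e * cinner e y)
    \<le> max 1 (cmod (\<alpha> - 1)) * (norm x * norm y) + cmod (cinner x y)"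
proof -
  define c where "c = cinner x e"
  define m where "m = max 1 (cmod (\<alpha> - 1))"
  define w where "w = x - c *\<^sub>C e"
  have orth: "cinner w e = 0" using e by (simp add: w_def c_def cinner_algebra cinner_norm)
  have x_sq: "(norm x)\<^sup>2 = (norm w)\<^sup>2 + (cmod c)\<^sup>2"
    using norm_add_sq[of w "c *\<^sub>C e"] orth e by (simp add: w_def cinner_scaleC_right norm_scaleC)
  \<comment> \<open>The map sending \<open>x\<close> to \<alpha> <x, e> e - x multiplies the
    component along \<open>e\<close> by \<alpha> - 1 and the orthogonal component by -1, so its norm
    is at most \<open>m\<close>.\<close>
  have "(norm (w - ((\<alpha> - 1) * c) *\<^sub>C e))\<^sup>2 = (norm w)\<^sup>2 + (cmod (\<alpha> - 1))\<^sup>2 * (cmod c)\<^sup>2"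
    using orth e by (simp add: norm_diff_sq cinner_scaleC_right norm_scaleC norm_mult power_mult_distrib)
  also have "\<dots> \<le> m\<^sup>2 * (norm w)\<^sup>2 + m\<^sup>2 * (cmod c)\<^sup>2"
  proof (intro add_mono mult_right_mono power_mono)
    have "1\<^sup>2 \<le> m\<^sup>2" unfolding m_def by (intro power_mono) auto
    then show "(norm w)\<^sup>2 \<le> m\<^sup>2 * (norm w)\<^sup>2" by (simp add: mult_le_cancel_right1)
  qed (auto simp: m_def)
  also have "\<dots> = (m * norm x)\<^sup>2" by (simp add: x_sq power_mult_distrib algebra_simps)
  finally have "norm (w - ((\<alpha> - 1) * c) *\<^sub>C e) \<le> m * norm x"
    by (rule power2_le_imp_le) (simp add: m_def)
  then have le: "norm ((\<alpha> * c) *\<^sub>C e - x) \<le> m * norm x"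
    unfolding w_def norm_minus_commute[of _ x]
    by (simp add: algebra_simps scaleC_add_left[symmetric])
  have "cmod \<alpha> * cmod (cinner x e * cinner e y) = cmod (cinner ((\<alpha> * c) *\<^sub>C e) y)"
    by (simp add: c_def cinner_scaleC_left norm_mult)
  also have "\<dots> = cmod (cinner ((\<alpha> * c) *\<^sub>C e - x) y + cinner x y)" by (simp add: cinner_diff_left)
  also have "\<dots> \<le> cmod (cinner ((\<alpha> * c) *\<^sub>C e - x) y) + cmod (cinner x y)" by (rule norm_triangle_ineq)
  also have "cmod (cinner ((\<alpha> * c) *\<^sub>C e - x) y) \<le> (m * norm x) * norm y"
    by (rule order_trans[OF cinner_Cauchy_Schwarz mult_right_mono[OF le]]) simp
  finally show ?thesis by (simp add: m_def mult.assoc)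
qed

section \<open>The numerical radius inequality\<close>

lemma A_norm_completion:
  assumes "is_A_completion A J"
  shows "A_norm A x = norm (blinfun_apply J x)"
  unfolding A_norm_def A_inner_def A_completionD(2)[OF assms, symmetric] by (simp add: Re_cinner_self)

text \<open>The norm of \<open>F\<close> bounds the set, so its supremum is meaningful; the estimate
  follows by rescaling \<open>x\<close> to seminorm 1 and is trivial for J x = 0.\<close>

lemma A_num_radius_completion:
  assumes c: "is_A_completion A J" and F: "\<And>x. blinfun_apply F (J x) = J (blinfun_apply T x)"
  shows "cmod (cinner (F (J x)) (J x)) \<le> A_num_radius A T * (norm (J x))\<^sup>2"
    and "A_num_radius A T \<ge> 0"
proof -
  let ?V = "insert 0 {cmod (A_inner A (T x) x) | x. A_norm A x = 1}"
  have inner: "A_inner A (T x) x = cinner (F (J x)) (J x)" for x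
    by (simp add: A_inner_def F A_completionD(2)[OF c])
  have "v \<le> norm F" if v: "v \<in> ?V" for v
  proof (cases "v = 0")
    case False
    then obtain x where v_eq: "v = cmod (cinner (F (J x)) (J x))" and x: "norm (J x) = 1"
      using v by (auto simp: inner A_norm_completion[OF c])
    show ?thesis
      using cinner_Cauchy_Schwarz[of "F (J x)" "J x"] norm_blinfun[of F "J x"] by (simp add: v_eq x)
  qed simp
  then have bdd: "bdd_above ?V" by (rule bdd_aboveI)
  show "A_num_radius A T \<ge> 0" unfolding A_num_radius_def by (rule cSup_upper[OF _ bdd]) simp
  show "cmod (cinner (F (J x)) (J x)) \<le> A_num_radius A T * (norm (J x))\<^sup>2"
  proof (cases "J x = 0")
    case False
    define k where "k = norm (J x)"
    have k: "k > 0" using False by (simp add: k_def)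
    define y where "y = (1 / k) *\<^sub>R x"
    have Jy: "J y = (1 / k) *\<^sub>R J x" by (simp add: y_def blinfun.scaleR_right)
    have "norm (J y) = 1" using k by (simp add: Jy k_def)
    then have "cmod (A_inner A (T y) y) \<in> ?V" by (auto simp: A_norm_completion[OF c])
    then have "cmod (cinner (F (J y)) (J y)) \<le> A_num_radius A T"
      unfolding A_num_radius_def inner by (rule cSup_upper) (use bdd inner in simp)
    moreover have "cmod (cinner (F (J y)) (J y)) = cmod (cinner (F (J x)) (J x)) / k\<^sup>2"
      using k by (simp add: Jy blinfun.scaleR_right cinner_scaleR_left cinner_scaleR_right
          norm_mult norm_divide power2_eq_square)
    ultimately show ?thesis using k by (simp add: field_simps flip: k_def)
  qed simp
qed

text \<open>The claim at a single unit vector e = (u, v), for T = [[0, F], [G, 0]]. The radii enter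
  through bounds at \<open>u\<close> and \<open>v\<close> only, because in the application such
  bounds are at hand for vectors in the range of \<open>J\<close>.\<close>

lemma pair_numerical_bound:
  fixes F G :: "'k::complex_hilbert \<Rightarrow>\<^sub>L 'k"
  assumes F: "F \<in> bounded_ops" and G: "G \<in> bounded_ops" and r: "r \<ge> 1" and \<alpha>: "\<alpha> \<noteq> 0"
    and unit: "(norm u)\<^sup>2 + (norm v)\<^sup>2 = 1"
    and wu: "cmod (cinner (F (G u)) u) \<le> w1 * (norm u)\<^sup>2"
    and wv: "cmod (cinner (G (F v)) v) \<le> w2 * (norm v)\<^sup>2"
    and w: "w1 \<ge> 0" "w2 \<ge> 0"
  shows "cmod (cinner (F v) u + cinner (G u) v) powr (2 * r)
    \<le> 2 powr (r - 2) * max 1 (cmod (\<alpha> - 1) powr r) / cmod \<alpha> powr r *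
        max (norm (powr_op (adjoint_op G o\<^sub>L G) r + powr_op (F o\<^sub>L adjoint_op F) r))
            (norm (powr_op (G o\<^sub>L adjoint_op G) r + powr_op (adjoint_op F o\<^sub>L F) r))
      + 2 powr (r - 1) / cmod \<alpha> powr r * max (w1 powr r) (w2 powr r)"
proof -
  note adjF = adjoint_op_works(2)[OF F] and adjG = adjoint_op_works(2)[OF G]
  note adjF' = adjoint_op_left[OF F] and adjG' = adjoint_op_left[OF G]
  define L where "L = powr_op (adjoint_op G o\<^sub>L G) r + powr_op (F o\<^sub>L adjoint_op F) r"
  define M where "M = powr_op (G o\<^sub>L adjoint_op G) r + powr_op (adjoint_op F o\<^sub>L F) r"
  \<comment> \<open>Here x = T e and \<open>y\<close> is the adjoint of \<open>T\<close> applied to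
    \<open>e\<close>, so <x, e> and <e, y> both equal <T e, e>.\<close>
  define x where "x = (F v, G u)"
  define y where "y = (adjoint_op G v, adjoint_op F u)"
  define z where "z = cmod (cinner (F v) u + cinner (G u) v)"
  define m where "m = max 1 (cmod (\<alpha> - 1))"
  define W where "W = cmod (cinner x y)"
  define N where "N = max (norm L) (norm M)"
  have e: "norm (u, v) = 1" using unit by (simp add: norm_prod_def)
  have xe: "cmod (cinner x (u, v)) = z" by (simp add: x_def z_def cinner_prod_def)
  have ey: "cmod (cinner (u, v) y) = z"
    by (simp add: y_def z_def cinner_prod_def adjF adjG add.commute flip: adjF adjG)
  have m: "m \<ge> 1" by (simp add: m_def)
  have Buzano: "cmod \<alpha> * z\<^sup>2 \<le> m * (norm x * norm y) + W"
    using generalized_Buzano[OF e, of \<alpha> x y] xe ey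
    by (simp add: norm_mult m_def W_def power2_eq_square)
  \<comment> \<open>The inner product <x, y> = <T^2 e, e> splits into <G F v, v> + <F G u,
    u>.\<close>
  have "W \<le> w2 * (norm v)\<^sup>2 + w1 * (norm u)\<^sup>2"
    unfolding W_def x_def y_def cinner_prod_def fst_conv snd_conv adjF[symmetric] adjG[symmetric]
    by (rule norm_triangle_le) (use wu wv in linarith)
  also have "\<dots> \<le> max w1 w2 * (norm v)\<^sup>2 + max w1 w2 * (norm u)\<^sup>2"
    by (intro add_mono mult_right_mono) auto
  also have "\<dots> = max w1 w2" using unit by (simp add: add.commute flip: distrib_left)
  finally have "W powr r \<le> max w1 w2 powr r" using r by (intro powr_mono2) (auto simp: W_def)
  then have W_le: "W powr r \<le> max (w1 powr r) (w2 powr r)" by (auto simp: max_def split: if_splits)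
  have quad: "Re (cinner (T w) w) \<le> norm T * (norm w)\<^sup>2" for T :: "'k \<Rightarrow>\<^sub>L 'k" and w
  proof -
    have "Re (cinner (T w) w) \<le> norm (T w) * norm w"
      by (rule order_trans[OF complex_Re_le_cmod cinner_Cauchy_Schwarz])
    also have "\<dots> \<le> (norm T * norm w) * norm w" by (intro mult_right_mono norm_blinfun) auto
    finally show ?thesis by (simp add: power2_eq_square)
  qed
  have unit': "(norm v)\<^sup>2 + (norm u)\<^sup>2 = 1" using unit by simp
  have norm_x: "(norm x)\<^sup>2 = Re (cinner ((adjoint_op F o\<^sub>L F) v) v) + Re (cinner ((adjoint_op G o\<^sub>L G) u) u)"
    by (simp add: x_def norm_prod_def adjF' adjG' Re_cinner_self)
  have norm_y: "(norm y)\<^sup>2 = Re (cinner ((G o\<^sub>L adjoint_op G) v) v) + Re (cinner ((F o\<^sub>L adjoint_op F) u) u)"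
    by (simp add: y_def norm_prod_def adjF adjG Re_cinner_self)
  have "(norm x)\<^sup>2 powr r \<le> Re (cinner (powr_op (adjoint_op F o\<^sub>L F) r v) v)
      + Re (cinner (powr_op (adjoint_op G o\<^sub>L G) r u) u)"
    unfolding norm_x
    by (rule McCarthy_pair[OF _ _ _ _ r unit'])
      (simp_all add: adjF' adjG' Re_cinner_self flip: adjF adjG)
  moreover have "(norm y)\<^sup>2 powr r \<le> Re (cinner (powr_op (G o\<^sub>L adjoint_op G) r v) v)
      + Re (cinner (powr_op (F o\<^sub>L adjoint_op F) r u) u)"
    unfolding norm_y
  proof (rule McCarthy_pair[OF _ _ _ _ r unit'])
    show "Re (cinner ((G o\<^sub>L adjoint_op G) w) w) \<ge> 0" "Re (cinner ((F o\<^sub>L adjoint_op F) w) w) \<ge> 0" for w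
      by (simp_all add: adjF adjG Re_cinner_self)
  qed (simp_all add: adjF adjG adjF' adjG')
  \<comment> \<open>The terms at \<open>v\<close> combine to \<open>M\<close>, those at
    \<open>u\<close> to \<open>L\<close>.\<close>
  ultimately have "(norm x)\<^sup>2 powr r + (norm y)\<^sup>2 powr r \<le> Re (cinner (M v) v) + Re (cinner (L u) u)"
    by (simp add: M_def L_def blinfun.add_left cinner_add_left)
  also have "\<dots> \<le> norm M * (norm v)\<^sup>2 + norm L * (norm u)\<^sup>2" by (intro add_mono quad)
  also have "\<dots> \<le> N * (norm v)\<^sup>2 + N * (norm u)\<^sup>2"
    by (intro add_mono mult_right_mono) (auto simp: N_def)
  also have "\<dots> = N" using unit' by (simp flip: distrib_left)
  finally have norms: "(norm x)\<^sup>2 powr r + (norm y)\<^sup>2 powr r \<le> N" .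
  have sq: "(a powr r)\<^sup>2 = a\<^sup>2 powr r" if "a \<ge> 0" for a :: real
    using that by (simp add: power2_eq_square powr_mult)
  \<comment> \<open>The arithmetic-geometric mean inequality supplies the factor 1/2 that turns 2^(r
    - 1) into 2^(r - 2).\<close>
  have "2 * (norm x powr r * norm y powr r) \<le> (norm x powr r)\<^sup>2 + (norm y powr r)\<^sup>2"
    using sum_squares_bound[of "norm x powr r" "norm y powr r"] by simp
  then have "2 * (norm x powr r * norm y powr r) \<le> N" using norms by (simp add: sq)
  then have a: "(m * (norm x * norm y)) powr r \<le> m powr r * (N / 2)"
    using m by (simp add: powr_mult mult_left_mono)
  have m_powr: "m powr r = max 1 (cmod (\<alpha> - 1) powr r)"
  proof (cases "cmod (\<alpha> - 1) \<le> 1")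
    case True
    then have "cmod (\<alpha> - 1) powr r \<le> 1 powr r" using r by (intro powr_mono2) auto
    then show ?thesis using True by (simp add: m_def)
  next
    case False
    then have "1 powr r \<le> cmod (\<alpha> - 1) powr r" using r by (intro powr_mono2) auto
    then show ?thesis using False by (simp add: m_def)
  qed
  have "cmod \<alpha> powr r * z powr (2 * r) = (cmod \<alpha> * z\<^sup>2) powr r"
    using sq[of z] powr_add[of z r r] by (simp add: powr_mult z_def power2_eq_square)
  also have "\<dots> \<le> (m * (norm x * norm y) + W) powr r"
    using Buzano r by (intro powr_mono2) auto
  also have "\<dots> \<le> 2 powr (r - 1) * ((m * (norm x * norm y)) powr r + W powr r)"
    using r m by (intro powr_add_le) (auto simp: W_def)
  also have "\<dots> \<le> 2 powr (r - 1) * (m powr r * (N / 2) + max (w1 powr r) (w2 powr r))"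
    by (intro mult_left_mono add_mono a W_le) auto
  also have "\<dots> = 2 powr (r - 2) * m powr r * N + 2 powr (r - 1) * max (w1 powr r) (w2 powr r)"
    by (simp add: powr_diff algebra_simps)
  finally have "z powr (2 * r) \<le> (2 powr (r - 2) * m powr r * N
      + 2 powr (r - 1) * max (w1 powr r) (w2 powr r)) / cmod \<alpha> powr r"
    using \<alpha> by (simp add: pos_le_divide_eq mult.commute)
  then show ?thesis
    by (simp add: m_powr N_def M_def L_def z_def add_divide_distrib)
qed

theorem theorem2p27:
  fixes A X Y :: "'h::complex_hilbert \<Rightarrow>\<^sub>L 'h"
    and J :: "'h \<Rightarrow>\<^sub>L 'k::complex_hilbert"
    and \<alpha> :: complex and r :: real
  assumes "positive_op A"
    and "is_A_completion A J"
    and "X \<in> A_adjointable A" and "Y \<in> A_adjointable A"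
    and "\<alpha> \<noteq> 0" and "r \<ge> 1"
  shows "A_num_radius (block_op A 0 0 A) (block_op 0 X Y 0) powr (2 * r)
    \<le> 2 powr (r - 2) * max 1 (cmod (\<alpha> - 1) powr r) / cmod \<alpha> powr r *
        max (powr_sum_norm J r (A_sharp A Y o\<^sub>L Y) (X o\<^sub>L A_sharp A X))
            (powr_sum_norm J r (Y o\<^sub>L A_sharp A Y) (A_sharp A X o\<^sub>L X))
      + 2 powr (r - 1) / cmod \<alpha> powr r
        * max (A_num_radius A (X o\<^sub>L Y) powr r) (A_num_radius A (Y o\<^sub>L X) powr r)"
proof -
  note c = assms(2) and X = assms(3) and Y = assms(4)
  have A: "A \<in> bounded_ops" using assms(1) by (simp add: positive_op_def)
  define F where "F = induced_op J X"
  define G where "G = induced_op J Y"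
  note F = induced_op_works[OF c X, folded F_def] and G = induced_op_works[OF c Y, folded G_def]
  note F_adj = adjoint_induced_op[OF A c X, folded F_def]
    and G_adj = adjoint_induced_op[OF A c Y, folded G_def]
  note bops = bounded_ops_compose F(1) G(1) adjoint_op_works(1)[OF F(1)] adjoint_op_works(1)[OF G(1)]
  \<comment> \<open>\<open>J\<close> intertwines the sharp operation with the adjoint, which carries
    \<lambda>_r and \<mu>_r over to the two norms bounded for \<open>F\<close> and
    \<open>G\<close>.\<close>
  have ind: "induced_op J (A_sharp A Y o\<^sub>L Y) = adjoint_op G o\<^sub>L G"
    "induced_op J (X o\<^sub>L A_sharp A X) = F o\<^sub>L adjoint_op F"
    "induced_op J (Y o\<^sub>L A_sharp A Y) = G o\<^sub>L adjoint_op G"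
    "induced_op J (A_sharp A X o\<^sub>L X) = adjoint_op F o\<^sub>L F"
    by (rule induced_op_eqI[OF c]; simp add: bops F(2) G(2) F_adj G_adj)+
  define w1 where "w1 = A_num_radius A (X o\<^sub>L Y)"
  define w2 where "w2 = A_num_radius A (Y o\<^sub>L X)"
  have w1: "cmod (cinner (F (G (J x))) (J x)) \<le> w1 * (norm (J x))\<^sup>2" "w1 \<ge> 0" for x
    using A_num_radius_completion[OF c, of "F o\<^sub>L G" "X o\<^sub>L Y"] by (simp_all add: F(2) G(2) w1_def)
  have w2: "cmod (cinner (G (F (J x))) (J x)) \<le> w2 * (norm (J x))\<^sup>2" "w2 \<ge> 0" for x
    using A_num_radius_completion[OF c, of "G o\<^sub>L F" "Y o\<^sub>L X"] by (simp_all add: F(2) G(2) w2_def)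
  define B where "B = 2 powr (r - 2) * max 1 (cmod (\<alpha> - 1) powr r) / cmod \<alpha> powr r *
        max (norm (powr_op (adjoint_op G o\<^sub>L G) r + powr_op (F o\<^sub>L adjoint_op F) r))
            (norm (powr_op (G o\<^sub>L adjoint_op G) r + powr_op (adjoint_op F o\<^sub>L F) r))
      + 2 powr (r - 1) / cmod \<alpha> powr r * max (w1 powr r) (w2 powr r)"
  \<comment> \<open>Nonnegativity lets the power 2 r undo the root of \<open>B\<close>.\<close>
  have B: "B \<ge> 0"
    unfolding B_def by (intro add_nonneg_nonneg mult_nonneg_nonneg divide_nonneg_nonneg)
      (auto simp: le_max_iff_disj)
  let ?A = "block_op A 0 0 A" and ?T = "block_op 0 X Y 0"
  \<comment> \<open>The supremum runs over \<open>v\<close> itself, so each \<open>v\<close> is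
    bounded by a root of \<open>B\<close> and the power is applied afterwards.\<close>
  have "v \<le> B powr (1 / (2 * r))"
    if v: "v \<in> insert 0 {cmod (A_inner ?A (?T x) x) | x. A_norm ?A x = 1}" for v
  proof (cases "v = 0")
    case False
    then obtain p q where v_eq: "v = cmod (A_inner ?A (?T (p, q)) (p, q))"
      and unit: "A_norm ?A (p, q) = 1" using v by auto
    \<comment> \<open>A unit vector (p, q) for the block seminorm corresponds to the unit vector (J
      p, J q) of the doubled completion.\<close>
    have "(norm (J p))\<^sup>2 + (norm (J q))\<^sup>2 = 1"
      using unit by (simp add: A_norm_def A_inner_def block_op_apply cinner_prod_def Re_cinner_self
          flip: A_completionD(2)[OF c])
    then have "cmod (cinner (F (J q)) (J p) + cinner (G (J p)) (J q)) powr (2 * r) \<le> B"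
      unfolding B_def
      by (intro pair_numerical_bound F(1) G(1) assms(5,6) w1 w2)
    moreover have "cinner (F (J q)) (J p) + cinner (G (J p)) (J q) = A_inner ?A (?T (p, q)) (p, q)"
      by (simp add: F(2) G(2) A_inner_def block_op_apply cinner_prod_def A_completionD(2)[OF c])
    ultimately have "v powr (2 * r) \<le> B" by (simp add: v_eq)
    then have "(v powr (2 * r)) powr (1 / (2 * r)) \<le> B powr (1 / (2 * r))"
      using assms(6) by (intro powr_mono2) auto
    moreover have "v \<ge> 0" by (simp add: v_eq)
    ultimately show ?thesis using assms(6) by (simp add: powr_powr)
  qed simp
  note le = this
  have "A_num_radius ?A ?T \<le> B powr (1 / (2 * r))"
    unfolding A_num_radius_def by (rule cSup_least[OF insert_not_empty le])
  \<comment> \<open>The inserted 0 makes the supremum nonnegative, as monotonicity of the power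
    requires.\<close>
  moreover have "A_num_radius ?A ?T \<ge> 0"
    unfolding A_num_radius_def by (rule cSup_upper[OF insertI1 bdd_aboveI[OF le]])
  ultimately have "A_num_radius ?A ?T powr (2 * r) \<le> (B powr (1 / (2 * r))) powr (2 * r)"
    using assms(6) by (intro powr_mono2) auto
  also have "\<dots> = B" using assms(6) B by (simp add: powr_powr)
  finally show ?thesis
    by (simp add: B_def powr_sum_norm_def ind w1_def w2_def)
qed

end
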